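(* For every $\alpha\in(0,1)$, the permuton \[\mu^m_\alpha=\sum_{i=1}^\infty(1-\alpha)\alpha^{i-1}\lambda_{I(1-\alpha^{i-1},\,1-\alpha^i)},\qquad I(z,z')=\{(x,z'+z-x): x\in[z,z']\},\] is finitely forcible.
   Context: A permuton is a probability measure $\mu$ on the Borel sets of $[0,1]^2$ with uniform marginals, i.e., $\mu([\alpha,\beta]\times[0,1])=\mu([0,1]\times[\alpha,\beta])=\beta-\alpha$ for all $0\le\alpha\le\beta\le1$. For a segment $A$, $\lambda_A$ is the probability measure uniformly distributed on $A$. A $\mu$-random permutation of order $n$ is obtained by sampling $n$ points independently according to $\mu$, ordering them by $x$-coordinate as $x_{i_1}<\dots<x_{i_n}$ and letting $\pi(j)<\pi(j')$ iff $y_{i_j}<y_{i_{j'}}$; $d(\sigma,\mu)$ is the probability that a $\mu$-random permutation of order $|\sigma|$ equals $\sigma$. A permuton $\mu$ is finitely forcible if there is a finite set $S$ of permutations such that every permuton $\mu'$ with $d(\sigma,\mu')=d(\sigma,\mu)$ for all $\sigma\in S$ equals $\mu$. *)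

theory Defs
  imports "HOL-Probability.Probability" "HOL-Combinatorics.Permutations"
begin

definition unit_square :: "(real \<times> real) set" where
  "unit_square = {0..1} \<times> {0..1}"

definition square_borel :: "(real \<times> real) measure" where
  "square_borel = restrict_space borel unit_square"

definition permuton :: "(real \<times> real) measure \<Rightarrow> bool" where
  "permuton \<mu> \<longleftrightarrow>
     prob_space \<mu> \<and> sets \<mu> = sets square_borel \<and>
     (\<forall>a b. 0 \<le> a \<and> a \<le> b \<and> b \<le> 1 \<longrightarrow>
        measure \<mu> ({a..b} \<times> {0..1}) = b - a \<and>
        measure \<mu> ({0..1} \<times> {a..b}) = b - a)"

text \<open>
  Permutations of order \<open>n\<close> are taken on \<open>{..<n}\<close>, so a permutation with its order is a
  pair \<open>(n, \<sigma>)\<close> with \<open>\<sigma> permutes {..<n}\<close>.  Below, \<open>i\<close> lists the indices of the sampled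
  points by increasing \<open>x\<close>-coordinate.  A sample in which two \<open>x\<close>- or two \<open>y\<close>-coordinates
  coincide induces no permutation; under a permuton such samples have probability 0.
\<close>

definition induces_perm :: "nat \<Rightarrow> (nat \<Rightarrow> real \<times> real) \<Rightarrow> (nat \<Rightarrow> nat) \<Rightarrow> bool" where
  "induces_perm n \<omega> \<sigma> \<longleftrightarrow> \<sigma> permutes {..<n} \<and>
     (\<exists>i. i permutes {..<n} \<and>
        (\<forall>j<n. \<forall>k<n. j < k \<longrightarrow> fst (\<omega> (i j)) < fst (\<omega> (i k))) \<and>
        (\<forall>j<n. \<forall>k<n. \<sigma> j < \<sigma> k \<longleftrightarrow> snd (\<omega> (i j)) < snd (\<omega> (i k))))"

definition perm_density :: "nat \<Rightarrow> (nat \<Rightarrow> nat) \<Rightarrow> (real \<times> real) measure \<Rightarrow> real" where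
  "perm_density n \<sigma> \<mu> =
     measure (\<Pi>\<^sub>M k\<in>{..<n}. \<mu>)
       {\<omega> \<in> space (\<Pi>\<^sub>M k\<in>{..<n}. \<mu>). induces_perm n \<omega> \<sigma>}"

definition finitely_forcible :: "(real \<times> real) measure \<Rightarrow> bool" where
  "finitely_forcible \<mu> \<longleftrightarrow> permuton \<mu> \<and>
     (\<exists>S :: (nat \<times> (nat \<Rightarrow> nat)) set.
        finite S \<and> (\<forall>(n, \<sigma>) \<in> S. \<sigma> permutes {..<n}) \<and>
        (\<forall>\<mu>'. permuton \<mu>' \<and>
           (\<forall>(n, \<sigma>) \<in> S. perm_density n \<sigma> \<mu>' = perm_density n \<sigma> \<mu>) \<longrightarrow> \<mu>' = \<mu>))"

text \<open>
  The uniform distribution on a segment is the image of the uniform distribution on \<open>[0,1]\<close>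
  under the affine parametrization.  It does not depend on the chosen endpoints, by
  \<open>uniform_on_segment_closed_segment\<close>.
\<close>

definition uniform_on_segment :: "(real \<times> real) set \<Rightarrow> (real \<times> real) measure" where
  "uniform_on_segment A =
     (let pq = (SOME pq. A = closed_segment (fst pq) (snd pq)) in
      distr (uniform_measure lborel {0..1}) borel
        (\<lambda>t. (1 - t) *\<^sub>R fst pq + t *\<^sub>R snd pq))"

definition antidiagonal :: "real \<Rightarrow> real \<Rightarrow> (real \<times> real) set" where
  "antidiagonal z z' = {(x, z' + z - x) | x. x \<in> {z..z'}}"

text \<open>The index is shifted: the summand for \<open>i\<close> is the usual one for \<open>i + 1\<close>.\<close>

definition mu_m :: "real \<Rightarrow> (real \<times> real) measure" where
  "mu_m \<alpha> =
     measure_of (space square_borel) (sets square_borel)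
       (\<lambda>B. \<Sum>i. ennreal ((1 - \<alpha>) * \<alpha> ^ i) *
              emeasure (uniform_on_segment (antidiagonal (1 - \<alpha> ^ i) (1 - \<alpha> ^ Suc i))) B)"

lemma uniform_measure_unit_reflect:
  "distr (uniform_measure lborel {0..1::real}) borel (\<lambda>t. 1 - t) = uniform_measure lborel {0..1}"
proof (rule measure_eqI)
  show "sets (distr (uniform_measure lborel {0..1::real}) borel (\<lambda>t. 1 - t)) =
      sets (uniform_measure lborel {0..1::real})" by simp
next
  fix B assume "B \<in> sets (distr (uniform_measure lborel {0..1::real}) borel (\<lambda>t. 1 - t))"
  then have B: "B \<in> sets borel" by simp
  have refl: "distr lborel borel (\<lambda>t::real. 1 - t) = lborel"
    using lborel_real_affine[of "-1" "1::real"] by (simp add: density_1)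
  have V: "(\<lambda>t::real. 1 - t) -` B \<in> sets borel"
    using measurable_sets[of "\<lambda>t::real. 1 - t" borel borel B] B by simp
  have "emeasure lborel ({0..1} \<inter> (\<lambda>t. 1 - t) -` B)
      = emeasure lborel ((\<lambda>t::real. 1 - t) -` ({0..1} \<inter> B))"
    by (rule arg_cong[where f = "emeasure lborel"]) auto
  also have "\<dots> = emeasure (distr lborel borel (\<lambda>t::real. 1 - t)) ({0..1} \<inter> B)"
    using B by (subst emeasure_distr) auto
  finally have "emeasure lborel ({0..1} \<inter> (\<lambda>t. 1 - t) -` B) = emeasure lborel ({0..1} \<inter> B)"
    by (simp add: refl)
  then show "emeasure (distr (uniform_measure lborel {0..1::real}) borel (\<lambda>t. 1 - t)) B =
      emeasure (uniform_measure lborel {0..1::real}) B"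
    using B V by (subst emeasure_distr) auto
qed

lemma uniform_on_segment_closed_segment:
  "uniform_on_segment (closed_segment p q) =
     distr (uniform_measure lborel {0..1}) borel (\<lambda>t. (1 - t) *\<^sub>R p + t *\<^sub>R q)"
proof -
  define pq where "pq = (SOME pq. closed_segment p q = closed_segment (fst pq) (snd pq))"
  have "closed_segment p q = closed_segment (fst pq) (snd pq)"
    unfolding pq_def by (rule someI[of _ "(p, q)"]) simp
  then have "{p, q} = {fst pq, snd pq}" by simp
  then consider "p = fst pq" "q = snd pq" | "p = snd pq" "q = fst pq"
    by (auto simp: doubleton_eq_iff)
  moreover have "distr (uniform_measure lborel {0..1}) borel (\<lambda>t. (1 - t) *\<^sub>R p + t *\<^sub>R q) =
      distr (uniform_measure lborel {0..1}) borel (\<lambda>t. (1 - t) *\<^sub>R q + t *\<^sub>R p)"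
    by (subst uniform_measure_unit_reflect[symmetric], subst distr_distr)
       (auto simp: comp_def add.commute)
  ultimately show ?thesis
    unfolding uniform_on_segment_def Let_def pq_def[symmetric] by cases simp_all
qed

lemma prob_space_uniform_on_segment: "prob_space (uniform_on_segment A)"
  unfolding uniform_on_segment_def Let_def
  by (intro prob_space.prob_space_distr prob_space_uniform_measure) auto

lemma antidiagonal_eq_closed_segment:
  assumes "z \<le> z'"
  shows "antidiagonal z z' = closed_segment (z, z') (z', z)"
proof (intro set_eqI iffI)
  fix v assume "v \<in> antidiagonal z z'"
  then obtain x where x: "v = (x, z' + z - x)" "z \<le> x" "x \<le> z'"
    by (auto simp: antidiagonal_def)
  show "v \<in> closed_segment (z, z') (z', z)"
  proof (cases "z = z'")
    case True with x show ?thesis by auto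
  next
    case False
    define u where "u = (x - z) / (z' - z)"
    have u: "0 \<le> u" "u \<le> 1" and "u * (z' - z) = x - z"
      using x False assms by (auto simp: u_def divide_simps)
    then have "v = (1 - u) *\<^sub>R (z, z') + u *\<^sub>R (z', z)"
      using x by (auto simp: algebra_simps)
    with u show ?thesis unfolding closed_segment_def by blast
  qed
next
  fix v assume "v \<in> closed_segment (z, z') (z', z)"
  then obtain u where u: "v = (1 - u) *\<^sub>R (z, z') + u *\<^sub>R (z', z)" "0 \<le> u" "u \<le> 1"
    by (auto simp: closed_segment_def)
  define x where "x = z + u * (z' - z)"
  have "v = (x, z' + z - x)" using u by (auto simp: x_def algebra_simps)
  moreover have "z \<le> x" "x \<le> z'"
    using u assms mult_left_le_one_le[of "z' - z" u] by (auto simp: x_def)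
  ultimately show "v \<in> antidiagonal z z'" by (auto simp: antidiagonal_def)
qed

lemma sets_mu_m [simp]: "sets (mu_m \<alpha>) = sets square_borel"
  unfolding mu_m_def by (simp add: sets.sigma_sets_eq sets.space_closed)

lemma emeasure_mu_m:
  assumes "B \<in> sets square_borel"
  shows "emeasure (mu_m \<alpha>) B =
    (\<Sum>i. ennreal ((1 - \<alpha>) * \<alpha> ^ i) *
       emeasure (uniform_on_segment (antidiagonal (1 - \<alpha> ^ i) (1 - \<alpha> ^ Suc i))) B)"
  unfolding mu_m_def
proof (rule emeasure_measure_of_sigma[OF _ _ _ assms])
  show "sigma_algebra (space square_borel) (sets square_borel)" ..
  have "unit_square \<in> sets borel"
    unfolding unit_square_def by (intro borel_closed closed_Times) auto
  then have sub: "sets square_borel \<subseteq> sets borel"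
    unfolding square_borel_def by (auto simp: sets_restrict_space)
  let ?\<nu> = "\<lambda>i. uniform_on_segment (antidiagonal (1 - \<alpha> ^ i) (1 - \<alpha> ^ Suc i))"
  let ?f = "\<lambda>B. \<Sum>i. ennreal ((1 - \<alpha>) * \<alpha> ^ i) * emeasure (?\<nu> i) B"
  show "positive (sets square_borel) ?f" by (simp add: positive_def)
  show "countably_additive (sets square_borel) ?f"
  proof (rule countably_additiveI)
    fix A :: "nat \<Rightarrow> (real \<times> real) set"
    assume A: "range A \<subseteq> sets square_borel" "disjoint_family A"
    have ad: "emeasure (?\<nu> i) (\<Union>j. A j) = (\<Sum>j. emeasure (?\<nu> i) (A j))" for i
      using A sub by (intro suminf_emeasure[symmetric])
        (auto simp: uniform_on_segment_def Let_def)
    have "(\<Sum>j. ?f (A j)) =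
        (\<Sum>i. \<Sum>j. ennreal ((1 - \<alpha>) * \<alpha> ^ i) * emeasure (?\<nu> i) (A j))"
      using nn_integral_suminf[of "\<lambda>i j. ennreal ((1 - \<alpha>) * \<alpha> ^ i) * emeasure (?\<nu> i) (A j)"
          "count_space UNIV"]
      by (simp add: nn_integral_count_space_nat)
    also have "\<dots> = ?f (\<Union>j. A j)" by (simp only: ad ennreal_suminf_cmult)
    finally show "(\<Sum>j. ?f (A j)) = ?f (\<Union>j. A j)" .
  qed
qed

end

theory Submission
  imports Defs
begin

text \<open>
  The densities of the permutations of order 3 suffice.  Call \<open>p\<close> below \<open>q\<close> if it is smaller in
  both coordinates, and let \<open>B p\<close> and \<open>A p\<close> be the masses of the points below and above \<open>p\<close>.
  The densities of order 3 determine the expectation of every function of three sampled points that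
  depends only on their relative order.  Among these are the probability that ``below'' is a
  strict weak order on the sample (that is, the patterns 231 and 312 do not occur) and the integral
  of \<open>(\<alpha> (1 - B p) - A p)\<^sup>2\<close>, which is an expectation over \<open>p\<close> and two further
  independent points.  For \<open>mu_m \<alpha>\<close> the former is 1 and the latter is 0.

  Conversely, suppose this holds for a permuton, so that \<open>A = \<alpha> u\<close> almost everywhere with
  \<open>u = 1 - B\<close>.  Comparing quadrants with half planes gives \<open>\<alpha> u \<le> 1 - x \<le> u\<close> and
  \<open>y = 2 - (1 + \<alpha>) u - x\<close> at \<open>p = (x, y)\<close>.  The weak order makes the values of \<open>u\<close> at almost
  all pairs of points equal or apart by a factor of at least \<open>1 / \<alpha>\<close>.  As \<open>1 - x\<close> is uniform, \<open>u\<close> has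
  to take the values 1, \<open>\<alpha>\<close>, \<open>\<alpha>\<^sup>2\<close>, ..., so \<open>u\<close> and \<open>y\<close> are functions of \<open>x\<close>, and a permuton
  concentrated on the graph of a function of \<open>x\<close> is determined by that function.
\<close>

subsection \<open>Order types\<close>

text \<open>Ties share a rank, so the comparison lemma needs no injectivity. Outside the range the
  map is the identity, as \<open>permutes\<close> demands.\<close>

definition rel_rank :: "nat \<Rightarrow> (nat \<Rightarrow> real) \<Rightarrow> nat \<Rightarrow> nat" where
  "rel_rank n x k = (if k < n then card {j. j < n \<and> x j < x k} else k)"

lemma rel_rank_less_iff:
  assumes "j < n" "k < n"
  shows "rel_rank n x j < rel_rank n x k \<longleftrightarrow> x j < x k"
proof -
  have less: "rel_rank n x j < rel_rank n x k" if "x j < x k" "j < n" "k < n" for j k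
    using that unfolding rel_rank_def by (auto intro!: psubset_card_mono)
  have eq: "rel_rank n x j = rel_rank n x k" if "x j = x k" "j < n" "k < n" for j k
    using that by (simp add: rel_rank_def)
  show ?thesis
    using less[of j k] less[of k j] eq[of j k] assms by (cases "x j" "x k" rule: linorder_cases) auto
qed

lemma rel_rank_permutes:
  assumes "inj_on x {..<n}"
  shows "rel_rank n x permutes {..<n}"
proof (rule bij_imp_permutes)
  have "inj_on (rel_rank n x) {..<n}"
  proof (rule inj_onI)
    fix j k assume "j \<in> {..<n}" "k \<in> {..<n}" "rel_rank n x j = rel_rank n x k"
    then have "x j = x k"
      using rel_rank_less_iff[of j n k x] rel_rank_less_iff[of k n j x] by auto
    with assms \<open>j \<in> _\<close> \<open>k \<in> _\<close> show "j = k" by (auto dest: inj_onD)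
  qed
  moreover have "rel_rank n x k < n" if "k < n" for k
  proof -
    have "card {j. j < n \<and> x j < x k} < card {..<n}"
      using that by (intro psubset_card_mono) auto
    then show ?thesis using that by (simp add: rel_rank_def)
  qed
  ultimately show "bij_betw (rel_rank n x) {..<n} {..<n}"
    unfolding bij_betw_def by (intro conjI card_subset_eq) (auto simp: card_image)
qed (simp add: rel_rank_def)

text \<open>A permutation of \<open>{..<n}\<close> is its own rank function: the indices with value
  below \<open>a k\<close> are the preimages of \<open>{..<a k}\<close>. Hence the comparisons alone
  determine the permutation.\<close>

lemma rel_rank_eqI:
  assumes a: "a permutes {..<n}"
    and eq: "\<And>j k. j < n \<Longrightarrow> k < n \<Longrightarrow> x j < x k \<longleftrightarrow> a j < a k"
  shows "rel_rank n x = a"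
proof
  fix k
  show "rel_rank n x k = a k"
  proof (cases "k < n")
    case True
    have lt: "a j < n \<longleftrightarrow> j < n" for j using permutes_in_image[OF a, of j] by simp
    have "card {j. j < n \<and> x j < x k} = card {j. j < n \<and> a j < a k}"
      using eq True by (intro arg_cong[where f = card]) auto
    also have " \<dots> = card (a ` {j. j < n \<and> a j < a k})"
      using permutes_inj[OF a] by (intro card_image[symmetric]) (auto simp: inj_on_def)
    also have "a ` {j. j < n \<and> a j < a k} = {..<a k}"
    proof (intro equalityI subsetI)
      fix m assume m: "m \<in> {..<a k}"
      then have "m < n" using lt[of k] True by auto
      with m have "a (inv a m) = m" "inv a m < n"
        using permutes_inverses(1)[OF a, of m] lt[of "inv a m"] by simp_all
      with m show "m \<in> a ` {j. j < n \<and> a j < a k}" by (intro image_eqI[of _ _ "inv a m"]) auto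
    qed auto
    finally show ?thesis using True by (simp add: rel_rank_def)
  next
    case False
    with a show ?thesis by (simp add: rel_rank_def permutes_def)
  qed
qed

text \<open>In contrast to \<open>induces_perm\<close>, the labels of the sample points are kept:
  \<open>a k\<close> and \<open>b k\<close> are the ranks of the two coordinates of point
  \<open>k\<close>. This makes order types mutually exclusive and lets them be permuted along with
  the labels.\<close>

definition order_type :: "nat \<Rightarrow> (nat \<Rightarrow> nat) \<Rightarrow> (nat \<Rightarrow> nat) \<Rightarrow> (nat \<Rightarrow> real \<times> real) \<Rightarrow> bool" where
  "order_type n a b \<omega> \<longleftrightarrow> (\<forall>j<n. \<forall>k<n.
     (fst (\<omega> j) < fst (\<omega> k) \<longleftrightarrow> a j < a k) \<and> (snd (\<omega> j) < snd (\<omega> k) \<longleftrightarrow> b j < b k))"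

lemma order_type_iff_rel_rank:
  assumes "a permutes {..<n}" "b permutes {..<n}"
  shows "order_type n a b \<omega> \<longleftrightarrow>
    rel_rank n (\<lambda>k. fst (\<omega> k)) = a \<and> rel_rank n (\<lambda>k. snd (\<omega> k)) = b"
proof
  assume "order_type n a b \<omega>"
  with assms show "rel_rank n (\<lambda>k. fst (\<omega> k)) = a \<and> rel_rank n (\<lambda>k. snd (\<omega> k)) = b"
    unfolding order_type_def by (blast intro: rel_rank_eqI)
next
  assume "rel_rank n (\<lambda>k. fst (\<omega> k)) = a \<and> rel_rank n (\<lambda>k. snd (\<omega> k)) = b"
  then have a: "a = rel_rank n (\<lambda>k. fst (\<omega> k))" and b: "b = rel_rank n (\<lambda>k. snd (\<omega> k))" by simp_all
  show "order_type n a b \<omega>"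
    unfolding order_type_def a b by (simp add: rel_rank_less_iff)
qed

lemma order_type_permute:
  assumes c: "c permutes {..<n}" and "\<And>k. k < n \<Longrightarrow> \<omega>' k = \<omega> (c k)"
  shows "order_type n (a \<circ> c) (b \<circ> c) \<omega>' \<longleftrightarrow> order_type n a b \<omega>"
proof -
  have lt: "c k < n \<longleftrightarrow> k < n" for k using permutes_in_image[OF c, of k] by simp
  have all: "(\<forall>j<n. \<forall>k<n. P j k) \<longleftrightarrow> (\<forall>j<n. \<forall>k<n. P (c j) (c k))" for P
    by (metis c lt permutes_inverses(1))
  show ?thesis
    unfolding order_type_def
      all[of "\<lambda>j k. (fst (\<omega> j) < fst (\<omega> k)) = (a j < a k) \<and> (snd (\<omega> j) < snd (\<omega> k)) = (b j < b k)"]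
    using assms(2) by simp
qed

text \<open>The enumeration of the points by increasing first coordinate is the inverse of the rank
  permutation \<open>a\<close>, so the point of horizontal rank \<open>a k\<close> has vertical rank
  \<open>\<sigma> (a k)\<close>.\<close>

lemma induces_perm_iff_order_type:
  "induces_perm n \<omega> \<sigma> \<longleftrightarrow>
     \<sigma> permutes {..<n} \<and> (\<exists>a. a permutes {..<n} \<and> order_type n a (\<sigma> \<circ> a) \<omega>)"
proof -
  have *: "order_type n id \<sigma> (\<omega> \<circ> i) \<longleftrightarrow>
      (\<forall>j<n. \<forall>k<n. j < k \<longrightarrow> fst (\<omega> (i j)) < fst (\<omega> (i k))) \<and>
      (\<forall>j<n. \<forall>k<n. \<sigma> j < \<sigma> k \<longleftrightarrow> snd (\<omega> (i j)) < snd (\<omega> (i k)))" for i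
    unfolding order_type_def by (auto, metis less_asym less_irrefl nat_neq_iff)
  have **: "order_type n (inv i) (\<sigma> \<circ> inv i) \<omega> \<longleftrightarrow> order_type n id \<sigma> (\<omega> \<circ> i)"
    if i: "i permutes {..<n}" for i
    using order_type_permute[OF i, of "\<omega> \<circ> i" \<omega> "inv i" "\<sigma> \<circ> inv i"]
    by (simp add: comp_assoc permutes_inv_o[OF i])
  show ?thesis
  proof safe
    assume "induces_perm n \<omega> \<sigma>"
    then obtain i where i: "i permutes {..<n}" and "order_type n id \<sigma> (\<omega> \<circ> i)"
      unfolding induces_perm_def * by auto
    with ** show "\<exists>a. a permutes {..<n} \<and> order_type n a (\<sigma> \<circ> a) \<omega>"
      using permutes_inv by blast
  next
    fix a assume "\<sigma> permutes {..<n}" and a: "a permutes {..<n}" and "order_type n a (\<sigma> \<circ> a) \<omega>"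
    moreover have "order_type n id \<sigma> (\<omega> \<circ> inv a)"
      using **[OF permutes_inv[OF a]] calculation by (simp add: permutes_inv_inv)
    ultimately show "induces_perm n \<omega> \<sigma>"
      unfolding induces_perm_def using * permutes_inv[OF a] by auto
  qed (simp add: induces_perm_def)
qed

lemma order_type_unique:
  assumes "a permutes {..<n}" "b permutes {..<n}" "a' permutes {..<n}" "b' permutes {..<n}"
    and "order_type n a b \<omega>" "order_type n a' b' \<omega>"
  shows "a = a'" "b = b'"
  using assms by (auto simp: order_type_iff_rel_rank)

definition order_invariant :: "nat \<Rightarrow> ((nat \<Rightarrow> real \<times> real) \<Rightarrow> 'a) \<Rightarrow> bool" where
  "order_invariant n G \<longleftrightarrow> (\<forall>\<omega> \<omega>'. (\<forall>j<n. \<forall>k<n.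
     (fst (\<omega> j) < fst (\<omega> k) \<longleftrightarrow> fst (\<omega>' j) < fst (\<omega>' k)) \<and>
     (snd (\<omega> j) < snd (\<omega> k) \<longleftrightarrow> snd (\<omega>' j) < snd (\<omega>' k))) \<longrightarrow> G \<omega> = G \<omega>')"

lemma order_invariant_order_type:
  assumes "order_invariant n G" "order_type n a b \<omega>"
  shows "G \<omega> = G (\<lambda>k. (real (a k), real (b k)))"
  using assms unfolding order_invariant_def order_type_def by auto

text \<open>Without ties exactly one pair of rank permutations fits the sample, so a single
  indicator survives. The points \<open>(a k, b k)\<close> serve as the standard configuration of
  that order type.\<close>

lemma order_invariant_eq_sum:
  fixes G :: "(nat \<Rightarrow> real \<times> real) \<Rightarrow> real"
  assumes G: "order_invariant n G"
    and x: "inj_on (\<lambda>k. fst (\<omega> k)) {..<n}" and y: "inj_on (\<lambda>k. snd (\<omega> k)) {..<n}"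
  shows "G \<omega> = (\<Sum>(a, b) \<in> {a. a permutes {..<n}} \<times> {b. b permutes {..<n}}.
     G (\<lambda>k. (real (a k), real (b k))) * indicator {\<omega>. order_type n a b \<omega>} \<omega>)"
proof -
  define a b where "a = rel_rank n (\<lambda>k. fst (\<omega> k))" and "b = rel_rank n (\<lambda>k. snd (\<omega> k))"
  have a: "a permutes {..<n}" and b: "b permutes {..<n}"
    using rel_rank_permutes x y by (auto simp: a_def b_def)
  have "(\<Sum>(a, b) \<in> {a. a permutes {..<n}} \<times> {b. b permutes {..<n}}.
     G (\<lambda>k. (real (a k), real (b k))) * indicator {\<omega>. order_type n a b \<omega>} \<omega>) =
     (\<Sum>(a', b') \<in> {(a, b)}.
     G (\<lambda>k. (real (a' k), real (b' k))) * indicator {\<omega>. order_type n a' b' \<omega>} \<omega>)"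
    using a b
    by (intro sum.mono_neutral_right)
      (auto simp: finite_permutations order_type_iff_rel_rank a_def b_def indicator_def
        split: if_splits)
  also have "\<dots> = G \<omega>"
    using order_invariant_order_type[OF G, of a b \<omega>] a b
    by (auto simp: order_type_iff_rel_rank a_def b_def)
  finally show ?thesis by simp
qed

subsection \<open>Expectations of order-invariant functions\<close>

text \<open>For a pair \<open>j\<close>, \<open>k\<close>, the product is written as coordinate
  \<open>j\<close> times the rest. Once coordinate \<open>j\<close> is fixed, coordinate
  \<open>k\<close> almost surely avoids the single value taken there, and Fubini concludes. There
  are only finitely many pairs.\<close>

lemma AE_PiM_inj_on:
  fixes f :: "'a \<Rightarrow> real"
  assumes "prob_space \<mu>" and f [measurable]: "f \<in> borel_measurable \<mu>"
    and atomless: "\<And>c. AE p in \<mu>. f p \<noteq> c"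
  shows "AE \<omega> in (\<Pi>\<^sub>M k\<in>{..<n::nat}. \<mu>). inj_on (\<lambda>k. f (\<omega> k)) {..<n}"
proof -
  interpret prob_space \<mu> by fact
  have neq: "AE \<omega> in (\<Pi>\<^sub>M k\<in>{..<n}. \<mu>). f (\<omega> j) \<noteq> f (\<omega> k)" if "j < n" "k < n" "j \<noteq> k" for j k
  proof -
    let ?I = "{..<n} - {j}" and ?g = "\<lambda>(x, X). X(j := x)"
    interpret I: prob_space "\<Pi>\<^sub>M i\<in>?I. \<mu>" by (intro prob_space_PiM) (rule prob_space_axioms)
    interpret pair_sigma_finite \<mu> "\<Pi>\<^sub>M i\<in>?I. \<mu>" ..
    have ins: "insert j ?I = {..<n}" and k: "k \<in> ?I" using that by auto
    have meas [measurable]: "(\<lambda>\<omega>. f (\<omega> j)) \<in> borel_measurable (\<Pi>\<^sub>M k\<in>{..<n}. \<mu>)"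
        "(\<lambda>\<omega>. f (\<omega> k)) \<in> borel_measurable (\<Pi>\<^sub>M k\<in>{..<n}. \<mu>)"
        "(\<lambda>\<omega>. f (\<omega> k)) \<in> borel_measurable (\<Pi>\<^sub>M k\<in>?I. \<mu>)"
      using that k by (auto intro!: measurable_PiM_component_rev f)
    have "?g \<in> (\<mu> \<Otimes>\<^sub>M (\<Pi>\<^sub>M i\<in>?I. \<mu>)) \<rightarrow>\<^sub>M (\<Pi>\<^sub>M i\<in>insert j ?I. \<mu>)"
      by measurable
    then have g: "?g \<in> (\<mu> \<Otimes>\<^sub>M (\<Pi>\<^sub>M i\<in>?I. \<mu>)) \<rightarrow>\<^sub>M (\<Pi>\<^sub>M i\<in>{..<n}. \<mu>)"
      by (simp only: ins)
    have "AE x in \<mu>. AE X in (\<Pi>\<^sub>M i\<in>?I. \<mu>). f x \<noteq> f (X k)"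
    proof (rule AE_I2)
      fix x
      show "AE X in (\<Pi>\<^sub>M i\<in>?I. \<mu>). f x \<noteq> f (X k)"
        using AE_PiM_component[of ?I "\<lambda>_. \<mu>" k "\<lambda>p. f p \<noteq> f x"] prob_space_axioms k atomless[of "f x"]
        by (auto elim: eventually_mono)
    qed
    moreover have "{z \<in> space (\<mu> \<Otimes>\<^sub>M (\<Pi>\<^sub>M i\<in>?I. \<mu>)). f (fst z) \<noteq> f (snd z k)}
        \<in> sets (\<mu> \<Otimes>\<^sub>M (\<Pi>\<^sub>M i\<in>?I. \<mu>))"
      by measurable
    ultimately have "AE z in \<mu> \<Otimes>\<^sub>M (\<Pi>\<^sub>M i\<in>?I. \<mu>). f (fst z) \<noteq> f (snd z k)"
      by (intro AE_pair_measure) auto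
    then have "AE z in \<mu> \<Otimes>\<^sub>M (\<Pi>\<^sub>M i\<in>?I. \<mu>). f (?g z j) \<noteq> f (?g z k)"
      by eventually_elim (use that in \<open>auto simp: split_beta\<close>)
    then have "AE \<omega> in distr (\<mu> \<Otimes>\<^sub>M (\<Pi>\<^sub>M i\<in>?I. \<mu>)) (\<Pi>\<^sub>M i\<in>{..<n}. \<mu>) ?g. f (\<omega> j) \<noteq> f (\<omega> k)"
      using borel_measurable_neq[OF meas(1,2)] by (subst AE_distr_iff[OF g]) auto
    moreover have "distr (\<mu> \<Otimes>\<^sub>M (\<Pi>\<^sub>M i\<in>?I. \<mu>)) (\<Pi>\<^sub>M i\<in>{..<n}. \<mu>) ?g = (\<Pi>\<^sub>M i\<in>{..<n}. \<mu>)"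
      using distr_pair_PiM_eq_PiM[of ?I "\<lambda>_. \<mu>" j] prob_space_axioms unfolding ins by simp
    ultimately show ?thesis by (elim subst)
  qed
  have "AE \<omega> in (\<Pi>\<^sub>M k\<in>{..<n}. \<mu>). \<forall>j\<in>{..<n}. \<forall>k\<in>{..<n}. j \<noteq> k \<longrightarrow> f (\<omega> j) \<noteq> f (\<omega> k)"
    using neq by (intro AE_finite_allI) auto
  then show ?thesis by eventually_elim (auto simp: inj_on_def)
qed

locale atomless_plane_prob_space = prob_space \<mu> for \<mu> :: "(real \<times> real) measure" +
  assumes fst_measurable [measurable]: "fst \<in> borel_measurable \<mu>"
    and snd_measurable [measurable]: "snd \<in> borel_measurable \<mu>"
    and fst_atomless: "AE p in \<mu>. fst p \<noteq> c"
    and snd_atomless: "AE p in \<mu>. snd p \<noteq> c"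
begin

abbreviation samples :: "nat \<Rightarrow> (nat \<Rightarrow> real \<times> real) measure" where
  "samples n \<equiv> \<Pi>\<^sub>M k\<in>{..<n}. \<mu>"

lemma component_measurable [measurable]:
  assumes "j < n"
  shows "(\<lambda>\<omega>. fst (\<omega> j)) \<in> borel_measurable (samples n)"
    and "(\<lambda>\<omega>. snd (\<omega> j)) \<in> borel_measurable (samples n)"
  using assms by (measurable, simp)+

lemma prob_space_samples: "prob_space (samples n)"
  by (intro prob_space_PiM) (rule prob_space_axioms)

lemma order_type_sets [measurable]: "{\<omega> \<in> space (samples n). order_type n a b \<omega>} \<in> sets (samples n)"
  unfolding order_type_def by measurable

text \<open>Samples are exchangeable: relabelling the points by \<open>inv a\<close> preserves the
  product measure and turns the horizontal rank permutation into the identity.\<close>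

lemma measure_order_type:
  assumes a: "a permutes {..<n}" and b: "b permutes {..<n}"
  shows "measure (samples n) {\<omega> \<in> space (samples n). order_type n a b \<omega>} =
    measure (samples n) {\<omega> \<in> space (samples n). order_type n id (b \<circ> inv a) \<omega>}"
proof -
  define t :: "(nat \<Rightarrow> real \<times> real) \<Rightarrow> nat \<Rightarrow> real \<times> real"
    where "t \<omega> = (\<lambda>k\<in>{..<n}. \<omega> (inv a k))" for \<omega>
  have ia: "inv a permutes {..<n}" using a by (rule permutes_inv)
  have t: "t \<in> samples n \<rightarrow>\<^sub>M samples n"
    unfolding t_def by (intro measurable_restrict) (use permutes_in_image[OF ia] in auto)
  have eq: "samples n = distr (samples n) (samples n) t"
    unfolding t_def
    by (rule distr_PiM_reindex[symmetric])
      (use permutes_in_image[OF ia] in \<open>auto intro: prob_space_axioms permutes_inj_on[OF ia]\<close>)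
  have "measure (samples n) {\<omega> \<in> space (samples n). order_type n id (b \<circ> inv a) \<omega>} =
      measure (samples n) (t -` {\<omega> \<in> space (samples n). order_type n id (b \<circ> inv a) \<omega>} \<inter> space (samples n))"
    by (subst (1) eq, subst measure_distr[OF t]) auto
  also have "t -` {\<omega> \<in> space (samples n). order_type n id (b \<circ> inv a) \<omega>} \<inter> space (samples n) =
      {\<omega> \<in> space (samples n). order_type n a b \<omega>}"
  proof -
    have "order_type n id (b \<circ> inv a) (t \<omega>) \<longleftrightarrow> order_type n a b \<omega>" for \<omega>
      using order_type_permute[OF ia, of "t \<omega>" \<omega> a b] by (simp add: t_def permutes_inv_o[OF a])
    then show ?thesis using measurable_space[OF t] by auto
  qed
  finally show ?thesis ..
qed

text \<open>The event splits into \<open>fact n\<close> disjoint labelled order types, one for each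
  \<open>a\<close>, all equally likely by exchangeability.\<close>

lemma perm_density_eq:
  assumes \<sigma>: "\<sigma> permutes {..<n}"
  shows "perm_density n \<sigma> \<mu> =
    fact n * measure (samples n) {\<omega> \<in> space (samples n). order_type n id \<sigma> \<omega>}"
proof -
  interpret P: prob_space "samples n" by (rule prob_space_samples)
  let ?E = "\<lambda>a. {\<omega> \<in> space (samples n). order_type n a (\<sigma> \<circ> a) \<omega>}"
  have "perm_density n \<sigma> \<mu> = measure (samples n) (\<Union>a\<in>{a. a permutes {..<n}}. ?E a)"
    unfolding perm_density_def
    by (intro arg_cong[where f = "measure (samples n)"]) (auto simp: induces_perm_iff_order_type \<sigma>)
  also have "\<dots> = (\<Sum>a\<in>{a. a permutes {..<n}}. measure (samples n) (?E a))"
  proof (rule P.finite_measure_finite_Union)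
    show "disjoint_family_on ?E {a. a permutes {..<n}}"
      using order_type_unique(1)[OF _ permutes_compose[OF _ \<sigma>] _ permutes_compose[OF _ \<sigma>]]
      unfolding disjoint_family_on_def by blast
  qed (auto simp: finite_permutations)
  also have "\<dots> = (\<Sum>a\<in>{a. a permutes {..<n}}.
      measure (samples n) {\<omega> \<in> space (samples n). order_type n id \<sigma> \<omega>})"
    by (intro sum.cong refl, subst measure_order_type)
      (auto simp: comp_assoc permutes_inv_o intro: permutes_compose \<sigma>)
  finally show ?thesis by (simp add: card_permutations)
qed

text \<open>The right-hand side involves the measure only through its densities of order
  \<open>n\<close>; this is how equal densities give equal expectations.\<close>

lemma expectation_order_invariant:
  fixes G :: "(nat \<Rightarrow> real \<times> real) \<Rightarrow> real"
  assumes G: "order_invariant n G" and [measurable]: "G \<in> borel_measurable (samples n)"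
  shows "(\<integral>\<omega>. G \<omega> \<partial>samples n) =
    (\<Sum>(a, b) \<in> {a. a permutes {..<n}} \<times> {b. b permutes {..<n}}.
       G (\<lambda>k. (real (a k), real (b k))) * (perm_density n (b \<circ> inv a) \<mu> / fact n))"
    (is "_ = (\<Sum>(a, b) \<in> ?I. ?G a b * _)")
proof -
  interpret P: prob_space "samples n" by (rule prob_space_samples)
  let ?E = "\<lambda>a b. {\<omega> \<in> space (samples n). order_type n a b \<omega>}"
  have "AE \<omega> in samples n. G \<omega> = (\<Sum>(a, b) \<in> ?I. ?G a b * indicator (?E a b) \<omega>)"
    using AE_PiM_inj_on[OF prob_space_axioms fst_measurable fst_atomless, of n]
      AE_PiM_inj_on[OF prob_space_axioms snd_measurable snd_atomless, of n] AE_space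
  proof eventually_elim
    case (elim \<omega>)
    then show ?case
      by (subst order_invariant_eq_sum[OF G elim(1,2)]) (auto intro!: sum.cong simp: indicator_def)
  qed
  then have "(\<integral>\<omega>. G \<omega> \<partial>samples n) = (\<integral>\<omega>. (\<Sum>(a, b) \<in> ?I. ?G a b * indicator (?E a b) \<omega>) \<partial>samples n)"
    by (intro integral_cong_AE) (auto simp: split_beta)
  also have "\<dots> = (\<Sum>(a, b) \<in> ?I. ?G a b * measure (samples n) (?E a b))"
    unfolding split_beta
    by (subst Bochner_Integration.integral_sum) (auto simp: P.emeasure_eq_measure)
  also have "\<dots> = (\<Sum>(a, b) \<in> ?I. ?G a b * (perm_density n (b \<circ> inv a) \<mu> / fact n))"
    by (intro sum.cong refl)
      (auto simp: perm_density_eq permutes_compose permutes_inv intro!: measure_order_type)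
  finally show ?thesis .
qed

end

subsection \<open>The dominance order on samples\<close>

definition sw :: "real \<times> real \<Rightarrow> real \<times> real \<Rightarrow> bool" where
  "sw p q \<longleftrightarrow> fst p < fst q \<and> snd p < snd q"

text \<open>This is negative transitivity. As \<open>sw\<close> is irreflexive and transitive, it
  makes \<open>sw\<close> a strict weak order on the sample, so that incomparability is an
  equivalence relation.\<close>

definition weakly_ordered :: "nat \<Rightarrow> (nat \<Rightarrow> real \<times> real) \<Rightarrow> bool" where
  "weakly_ordered n \<omega> \<longleftrightarrow> (\<forall>i<n. \<forall>j<n. \<forall>k<n. sw (\<omega> i) (\<omega> j) \<longrightarrow> sw (\<omega> i) (\<omega> k) \<or> sw (\<omega> k) (\<omega> j))"

text \<open>Chosen so that its integral over \<open>q\<close> is \<open>\<alpha> (1 - B p) - A p\<close>.\<close>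

definition kernel :: "real \<Rightarrow> real \<times> real \<Rightarrow> real \<times> real \<Rightarrow> real" where
  "kernel \<alpha> p q = (if sw q p then 0 else \<alpha>) - (if sw p q then 1 else 0)"

lemma order_invariant_weakly_ordered: "order_invariant n (\<lambda>\<omega>. of_bool (weakly_ordered n \<omega>) :: real)"
  unfolding order_invariant_def weakly_ordered_def sw_def by auto

lemma order_invariant_kernel:
  "order_invariant 3 (\<lambda>\<omega>. kernel \<alpha> (\<omega> 0) (\<omega> 1) * kernel \<alpha> (\<omega> 0) (\<omega> 2))"
  unfolding order_invariant_def kernel_def sw_def by (simp add: eval_nat_numeral less_Suc_eq)

context atomless_plane_prob_space begin

definition below :: "real \<times> real \<Rightarrow> real" where
  "below p = prob {q \<in> space \<mu>. sw q p}"

definition above :: "real \<times> real \<Rightarrow> real" where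
  "above p = prob {q \<in> space \<mu>. sw p q}"

lemma sw_sets [measurable]:
  "{q \<in> space \<mu>. sw q p} \<in> events" "{q \<in> space \<mu>. sw p q} \<in> events"
  unfolding sw_def by measurable

lemma kernel_measurable [measurable]: "case_prod (kernel \<alpha>) \<in> borel_measurable (\<mu> \<Otimes>\<^sub>M \<mu>)"
  unfolding kernel_def sw_def split_beta' by measurable

lemma kernel_measurable' [measurable]: "kernel \<alpha> p \<in> borel_measurable \<mu>"
  unfolding kernel_def sw_def by measurable

lemma weakly_ordered_measurable [measurable]:
  "(\<lambda>\<omega>. of_bool (weakly_ordered n \<omega>) :: real) \<in> borel_measurable (samples n)"
proof -
  have [measurable]: "Measurable.pred (samples n) (\<lambda>\<omega>. weakly_ordered n \<omega>)"
    unfolding weakly_ordered_def sw_def by measurable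
  show ?thesis by measurable
qed

lemma kernel_samples_measurable [measurable]:
  "(\<lambda>\<omega>. kernel \<alpha> (\<omega> 0) (\<omega> 1) * kernel \<alpha> (\<omega> 0) (\<omega> 2)) \<in> borel_measurable (samples 3)"
  unfolding kernel_def sw_def by measurable

lemma integral_kernel: "(\<integral>q. kernel \<alpha> p q \<partial>\<mu>) = \<alpha> * (1 - below p) - above p"
proof -
  have "(\<integral>q. kernel \<alpha> p q \<partial>\<mu>) =
      (\<integral>q. \<alpha> - \<alpha> * indicator {q \<in> space \<mu>. sw q p} q - indicator {q \<in> space \<mu>. sw p q} q \<partial>\<mu>)"
    by (intro Bochner_Integration.integral_cong) (auto simp: kernel_def)
  also have "\<dots> = \<alpha> - \<alpha> * below p - above p"
    by (simp add: below_def above_def emeasure_eq_measure prob_space)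
  finally show ?thesis by (simp add: algebra_simps)
qed

section \<open>Triples of independent points and Fubini\<close>

lemma samples_3_eq_distr:
  "samples 3 = distr (\<mu> \<Otimes>\<^sub>M (\<mu> \<Otimes>\<^sub>M \<mu>)) (samples 3)
     (\<lambda>(p, q, r). \<lambda>k\<in>{..<3}. if k = 0 then p else if k = 1 then q else r)"
proof -
  interpret pp: pair_sigma_finite \<mu> \<mu> ..
  interpret PP: prob_space "\<mu> \<Otimes>\<^sub>M \<mu>" by (rule prob_space_pair) (rule prob_space_axioms)+
  interpret ppp: pair_sigma_finite \<mu> "\<mu> \<Otimes>\<^sub>M \<mu>" ..
  interpret product_sigma_finite "\<lambda>_::nat. \<mu>" ..
  let ?f = "\<lambda>(p, q, r). \<lambda>k\<in>{..<3::nat}. if k = 0 then p else if k = 1 then q else r"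
  have f [measurable]: "?f \<in> (\<mu> \<Otimes>\<^sub>M (\<mu> \<Otimes>\<^sub>M \<mu>)) \<rightarrow>\<^sub>M samples 3"
    unfolding split_beta' by measurable
  have three: "{..<3::nat} = {0, 1, 2}" by auto
  show ?thesis
  proof (rule PiM_eqI[symmetric])
    fix A :: "nat \<Rightarrow> (real \<times> real) set" assume A: "\<And>i. i \<in> {..<3} \<Longrightarrow> A i \<in> events"
    then have A': "A 0 \<in> events" "A 1 \<in> events" "A 2 \<in> events" by simp_all
    have "?f -` (Pi\<^sub>E {..<3} A) \<inter> space (\<mu> \<Otimes>\<^sub>M (\<mu> \<Otimes>\<^sub>M \<mu>)) = A 0 \<times> A 1 \<times> A 2"
      using A'[THEN sets.sets_into_space] by (auto simp: space_pair_measure three PiE_iff)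
    then have "emeasure (distr (\<mu> \<Otimes>\<^sub>M (\<mu> \<Otimes>\<^sub>M \<mu>)) (samples 3) ?f) (Pi\<^sub>E {..<3} A) =
        emeasure (\<mu> \<Otimes>\<^sub>M (\<mu> \<Otimes>\<^sub>M \<mu>)) (A 0 \<times> A 1 \<times> A 2)"
      using A by (subst emeasure_distr[OF f]) (auto intro!: sets_PiM_I_finite)
    also have "\<dots> = emeasure \<mu> (A 0) * (emeasure \<mu> (A 1) * emeasure \<mu> (A 2))"
      using A' by (simp add: sigma_finite_measure.emeasure_pair_measure_Times[OF prob_space_imp_sigma_finite[OF PP.prob_space_axioms]]
          sigma_finite_measure.emeasure_pair_measure_Times[OF prob_space_imp_sigma_finite[OF prob_space_axioms]])
    finally show "emeasure (distr (\<mu> \<Otimes>\<^sub>M (\<mu> \<Otimes>\<^sub>M \<mu>)) (samples 3) ?f) (Pi\<^sub>E {..<3} A) =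
        (\<Prod>i\<in>{..<3}. emeasure \<mu> (A i))"
      by (simp add: three mult.assoc)
  qed auto
qed

lemma AE_samples_3D:
  assumes "AE \<omega> in samples 3. P (\<omega> 0) (\<omega> 1) (\<omega> 2)"
  shows "AE p in \<mu>. AE q in \<mu>. AE r in \<mu>. P p q r"
proof -
  interpret pp: pair_sigma_finite \<mu> \<mu> ..
  interpret PP: prob_space "\<mu> \<Otimes>\<^sub>M \<mu>" by (rule prob_space_pair) (rule prob_space_axioms)+
  interpret ppp: pair_sigma_finite \<mu> "\<mu> \<Otimes>\<^sub>M \<mu>" ..
  have f [measurable]: "(\<lambda>(p, q, r). \<lambda>k\<in>{..<3::nat}. if k = 0 then p else if k = 1 then q else r)
      \<in> (\<mu> \<Otimes>\<^sub>M (\<mu> \<Otimes>\<^sub>M \<mu>)) \<rightarrow>\<^sub>M samples 3"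
    unfolding split_beta' by measurable
  have "AE z in \<mu> \<Otimes>\<^sub>M (\<mu> \<Otimes>\<^sub>M \<mu>). P (fst z) (fst (snd z)) (snd (snd z))"
    using assms by (subst (asm) samples_3_eq_distr) (auto dest: AE_distrD[OF f] simp: split_beta)
  then have "AE p in \<mu>. AE z in \<mu> \<Otimes>\<^sub>M \<mu>. P p (fst z) (snd z)"
    using ppp.AE_pair by fastforce
  then show ?thesis
    by (rule eventually_mono) (use pp.AE_pair in fastforce)
qed

text \<open>Given the first point, the other two are independent and enter through the same kernel,
  so the inner double integral is the square of \<open>integral_kernel\<close>.\<close>

lemma integral_kernel_product:
  "(\<integral>\<omega>. kernel \<alpha> (\<omega> 0) (\<omega> 1) * kernel \<alpha> (\<omega> 0) (\<omega> 2) \<partial>samples 3) =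
     (\<integral>p. (\<alpha> * (1 - below p) - above p)\<^sup>2 \<partial>\<mu>)"
proof -
  interpret pp: pair_sigma_finite \<mu> \<mu> ..
  interpret PP: prob_space "\<mu> \<Otimes>\<^sub>M \<mu>" by (rule prob_space_pair) (rule prob_space_axioms)+
  interpret ppp: pair_sigma_finite \<mu> "\<mu> \<Otimes>\<^sub>M \<mu>" ..
  interpret PPP: prob_space "\<mu> \<Otimes>\<^sub>M (\<mu> \<Otimes>\<^sub>M \<mu>)"
    by (rule prob_space_pair) (rule prob_space_axioms PP.prob_space_axioms)+
  have f [measurable]: "(\<lambda>(p, q, r). \<lambda>k\<in>{..<3::nat}. if k = 0 then p else if k = 1 then q else r)
      \<in> (\<mu> \<Otimes>\<^sub>M (\<mu> \<Otimes>\<^sub>M \<mu>)) \<rightarrow>\<^sub>M samples 3"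
    unfolding split_beta' by measurable
  have bound: "\<bar>kernel \<alpha> p q\<bar> \<le> \<bar>\<alpha>\<bar> + 1" for p q
    by (auto simp: kernel_def)
  have bound2: "\<bar>kernel \<alpha> p q * kernel \<alpha> p r\<bar> \<le> (\<bar>\<alpha>\<bar> + 1) * (\<bar>\<alpha>\<bar> + 1)" for p q r
    unfolding abs_mult by (intro mult_mono bound) auto
  have int2: "integrable (\<mu> \<Otimes>\<^sub>M \<mu>) (\<lambda>(q, r). kernel \<alpha> p q * kernel \<alpha> p r)" for p
    using bound2 by (intro PP.integrable_const_bound[where B = "(\<bar>\<alpha>\<bar> + 1) * (\<bar>\<alpha>\<bar> + 1)"])
      (auto simp: split_beta)
  have int3: "integrable (\<mu> \<Otimes>\<^sub>M (\<mu> \<Otimes>\<^sub>M \<mu>)) (\<lambda>(p, q, r). kernel \<alpha> p q * kernel \<alpha> p r)"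
    using bound2 by (intro PPP.integrable_const_bound[where B = "(\<bar>\<alpha>\<bar> + 1) * (\<bar>\<alpha>\<bar> + 1)"])
      (auto simp: split_beta)
  have "(\<integral>\<omega>. kernel \<alpha> (\<omega> 0) (\<omega> 1) * kernel \<alpha> (\<omega> 0) (\<omega> 2) \<partial>samples 3) =
      (\<integral>z. (case z of (p, q, r) \<Rightarrow> kernel \<alpha> p q * kernel \<alpha> p r) \<partial>(\<mu> \<Otimes>\<^sub>M (\<mu> \<Otimes>\<^sub>M \<mu>)))"
    by (subst samples_3_eq_distr, subst integral_distr[OF f]) (auto simp: case_prod_unfold)
  also have "\<dots> = (\<integral>p. (\<integral>z. (case z of (q, r) \<Rightarrow> kernel \<alpha> p q * kernel \<alpha> p r) \<partial>(\<mu> \<Otimes>\<^sub>M \<mu>)) \<partial>\<mu>)"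
    using ppp.integral_fst'[OF int3] by simp
  also have "\<dots> = (\<integral>p. (\<integral>q. (\<integral>r. kernel \<alpha> p q * kernel \<alpha> p r \<partial>\<mu>) \<partial>\<mu>) \<partial>\<mu>)"
    using pp.integral_fst'[OF int2] by simp
  also have "\<dots> = (\<integral>p. (\<alpha> * (1 - below p) - above p)\<^sup>2 \<partial>\<mu>)"
    by (simp add: integral_kernel power2_eq_square)
  finally show ?thesis .
qed

lemma above_below_measurable [measurable]:
  "(\<lambda>p. \<alpha> * (1 - below p) - above p) \<in> borel_measurable \<mu>"
  using borel_measurable_lebesgue_integral[OF kernel_measurable, of \<alpha>]
  by (simp add: integral_kernel)

text \<open>The integral of a square vanishes only if the square does almost everywhere. An almost
  sure identity between \<open>above\<close> and \<open>below\<close> thus becomes a statement about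
  one expectation over three points.\<close>

lemma above_eq_iff:
  "(\<integral>\<omega>. kernel \<alpha> (\<omega> 0) (\<omega> 1) * kernel \<alpha> (\<omega> 0) (\<omega> 2) \<partial>samples 3) = 0 \<longleftrightarrow>
     (AE p in \<mu>. above p = \<alpha> * (1 - below p))"
proof -
  have "0 \<le> below p" "below p \<le> 1" "0 \<le> above p" "above p \<le> 1" for p
    by (auto simp: below_def above_def)
  note bounds = this
  have "\<bar>\<alpha> * (1 - below p) - above p\<bar> \<le> \<bar>\<alpha>\<bar> * 1 + 1" for p
    using bounds[of p] by (intro order_trans[OF abs_triangle_ineq4] add_mono) (auto simp: abs_mult intro!: mult_left_le)
  then have "integrable \<mu> (\<lambda>p. (\<alpha> * (1 - below p) - above p)\<^sup>2)"
    by (intro integrable_const_bound[of _ "(\<bar>\<alpha>\<bar> * 1 + 1)\<^sup>2"]) (auto intro!: power2_le_iff_abs_le[THEN iffD2])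
  then show ?thesis
    unfolding integral_kernel_product by (subst integral_nonneg_eq_0_iff_AE) (auto simp: algebra_simps)
qed

lemma weakly_ordered_iff:
  "(\<integral>\<omega>. of_bool (weakly_ordered n \<omega>) \<partial>samples n) = (1 :: real) \<longleftrightarrow> (AE \<omega> in samples n. weakly_ordered n \<omega>)"
proof -
  interpret P: prob_space "samples n" by (rule prob_space_samples)
  have [measurable]: "Measurable.pred (samples n) (\<lambda>\<omega>. weakly_ordered n \<omega>)"
    unfolding weakly_ordered_def sw_def by measurable
  have "(\<integral>\<omega>. of_bool (weakly_ordered n \<omega>) \<partial>samples n) =
      (\<integral>\<omega>. indicator {\<omega> \<in> space (samples n). weakly_ordered n \<omega>} \<omega> \<partial>samples n :: real)"
    by (intro Bochner_Integration.integral_cong) auto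
  also have "\<dots> = P.prob {\<omega> \<in> space (samples n). weakly_ordered n \<omega>}" by simp
  finally show ?thesis by (simp add: P.prob_Collect_eq_1)
qed

end

subsection \<open>Geometric levels\<close>

text \<open>The least power of \<open>\<alpha>\<close> that is at least \<open>w\<close>, for \<open>0 < w \<le> 1\<close>.\<close>

definition block_top :: "real \<Rightarrow> real \<Rightarrow> real" where
  "block_top \<alpha> w = \<alpha> powr of_int \<lfloor>log \<alpha> w\<rfloor>"

text \<open>On the block with top \<open>u\<close>, where \<open>x\<close> runs from
  \<open>1 - u\<close> to \<open>1 - \<alpha> * u\<close>, the antidiagonal has coordinate sum
  \<open>(1 - u) + (1 - \<alpha> * u)\<close>. The graph of \<open>layer\<close> is therefore the
  union of these segments without their right endpoints.\<close>

definition layer :: "real \<Rightarrow> real \<Rightarrow> real" where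
  "layer \<alpha> x = 2 - (1 + \<alpha>) * block_top \<alpha> (1 - x) - x"

lemma layer_measurable [measurable]: "layer \<alpha> \<in> borel_measurable borel"
  unfolding layer_def block_top_def by measurable

context
  fixes \<alpha> :: real
  assumes \<alpha>: "0 < \<alpha>" "\<alpha> < 1"
begin

text \<open>Since the base is less than 1, the logarithm is decreasing and the assumptions say that
  \<open>log \<alpha> w\<close> lies in the interval from \<open>i\<close> to \<open>i + 1\<close>,
  with \<open>i\<close> included and \<open>i + 1\<close> excluded.\<close>

lemma block_top_eqI:
  assumes "\<alpha> * \<alpha> ^ i < w" "w \<le> \<alpha> ^ i"
  shows "block_top \<alpha> w = \<alpha> ^ i"
proof -
  have w: "0 < w" using assms(1) \<alpha> by (smt (verit) zero_less_power mult_pos_pos)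
  have "log \<alpha> (\<alpha> ^ i) \<le> log \<alpha> w"
    using assms w \<alpha> by (simp add: log_def divide_right_mono_neg)
  moreover have "log \<alpha> w < log \<alpha> (\<alpha> ^ Suc i)"
    using assms w \<alpha> by (simp add: log_def divide_strict_right_mono_neg del: ln_mult)
  moreover have "log \<alpha> (\<alpha> ^ k) = real k" for k
    using \<alpha> by (simp add: log_nat_power)
  ultimately have "\<lfloor>log \<alpha> w\<rfloor> = int i" unfolding floor_eq_iff by (simp del: power_Suc)
  then show ?thesis using \<alpha> by (simp add: block_top_def powr_realpow)
qed

lemma block_exists:
  assumes "0 < w" "w \<le> 1"
  obtains i where "\<alpha> * \<alpha> ^ i < w" "w \<le> \<alpha> ^ i"
proof -
  define n where "n = (LEAST n. \<alpha> ^ n < w)"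
  have ex: "\<exists>n. \<alpha> ^ n < w" using real_arch_pow_inv[OF assms(1) \<alpha>(2)] .
  then have n: "\<alpha> ^ n < w" unfolding n_def by (rule LeastI_ex)
  then have "n \<noteq> 0" using assms by (intro notI) auto
  then obtain i where i: "n = Suc i" using not0_implies_Suc by blast
  then have "w \<le> \<alpha> ^ i" using not_less_Least[of i "\<lambda>n. \<alpha> ^ n < w"] by (simp add: n_def not_less)
  then show thesis using n i by (intro that[of i]) auto
qed

lemma block_top_bounds:
  assumes "0 < w" "w \<le> 1"
  shows "\<alpha> * block_top \<alpha> w < w" "w \<le> block_top \<alpha> w" "block_top \<alpha> w \<le> 1"
  using block_exists[OF assms] block_top_eqI \<alpha> power_le_one[of \<alpha>] by (metis less_eq_real_def)+

lemma block_top_less_imp: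
  assumes "0 < w" "w \<le> 1" "0 < w'" "w' \<le> 1" "block_top \<alpha> w < block_top \<alpha> w'"
  shows "block_top \<alpha> w \<le> \<alpha> * block_top \<alpha> w'"
proof -
  obtain i where i: "block_top \<alpha> w = \<alpha> ^ i" using block_exists[OF assms(1,2)] block_top_eqI by metis
  obtain j where j: "block_top \<alpha> w' = \<alpha> ^ j" using block_exists[OF assms(3,4)] block_top_eqI by metis
  from assms(5) have "j < i" unfolding i j using \<alpha> by (simp add: power_strict_decreasing_iff)
  then have "\<alpha> ^ i \<le> \<alpha> ^ Suc j" using \<alpha> by (intro power_decreasing) auto
  then show ?thesis using i j by simp
qed

text \<open>The numbers with top \<open>u\<close> fill the interval from \<open>\<alpha> * u\<close>
  (excluded) to \<open>u\<close> (included), so comparing tops amounts to comparing one number with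
  an end of the other block. In \<open>mu_m_above\<close> these forms turn quadrants into half
  planes.\<close>

lemma block_top_less_iff:
  assumes "0 < w" "w \<le> 1" "0 < w'" "w' \<le> 1"
  shows "block_top \<alpha> w < block_top \<alpha> w' \<longleftrightarrow> w \<le> \<alpha> * block_top \<alpha> w'"
    and "block_top \<alpha> w < block_top \<alpha> w' \<longleftrightarrow> block_top \<alpha> w < w'"
  using block_top_less_imp[OF assms] block_top_bounds[OF assms(1,2)] block_top_bounds[OF assms(3,4)]
    block_top_less_imp[OF assms(3,4,1,2)] \<alpha> mult_strict_left_mono[of "block_top \<alpha> w'" "block_top \<alpha> w" \<alpha>]
  by (smt (verit))+

lemma sw_layer_iff:
  assumes "0 \<le> x" "x < 1" "0 \<le> x'" "x' < 1"
  shows "sw (x, layer \<alpha> x) (x', layer \<alpha> x') \<longleftrightarrow> block_top \<alpha> (1 - x') < block_top \<alpha> (1 - x)"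
proof -
  define w w' u u' where "w = 1 - x" "w' = 1 - x'" "u = block_top \<alpha> w" "u' = block_top \<alpha> w'"
  note defs = this
  have w: "0 < w" "w \<le> 1" "0 < w'" "w' \<le> 1" using assms by (auto simp: defs)
  note b = block_top_bounds[OF w(1,2), folded defs] block_top_bounds[OF w(3,4), folded defs]
    block_top_less_imp[OF w, folded defs] block_top_less_imp[OF w(3,4,1,2), folded defs]
  have "sw (x, layer \<alpha> x) (x', layer \<alpha> x') \<longleftrightarrow> w' < w \<and> (1 + \<alpha>) * u' - w' < (1 + \<alpha>) * u - w"
    by (auto simp: sw_def layer_def defs algebra_simps)
  \<comment> \<open>If \<open>u' < u\<close>, then
    \<open>w' \<le> u' \<le> \<alpha> * u < w\<close>, and \<open>(1 + \<alpha>) * u' - w' < u'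
    \<le> \<alpha> * u \<le> (1 + \<alpha>) * u - w\<close>, because
    \<open>\<alpha> * u' < w'\<close> and \<open>w \<le> u\<close>. For equal tops the two
    inequalities contradict each other, and for \<open>u < u'\<close> the first one fails.\<close>
  also have "\<dots> \<longleftrightarrow> u' < u"
    using b by (cases u u' rule: linorder_cases) (auto simp: algebra_simps)
  finally show ?thesis by (simp add: defs)
qed

end

text \<open>The levels are peeled off from the top. If the remaining values are at most
  \<open>\<alpha> ^ n\<close>, a typical point \<open>p\<close> with \<open>w p\<close> just below
  \<open>\<alpha> ^ n\<close> has \<open>u p\<close> squeezed between \<open>w p\<close> and
  \<open>\<alpha> ^ n\<close>. Comparison with \<open>p\<close> forces almost every other remaining
  value to equal \<open>u p\<close> or to be at most \<open>\<alpha> ^ Suc n\<close>.\<close>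

lemma (in prob_space) AE_geometric_levels:
  fixes u w :: "'a \<Rightarrow> real"
  assumes \<alpha>: "0 < \<alpha>" "\<alpha> < 1"
    and w [measurable]: "w \<in> borel_measurable M"
    and pos: "\<And>a b. 0 \<le> a \<Longrightarrow> a < b \<Longrightarrow> b \<le> 1 \<Longrightarrow> 0 < prob {p \<in> space M. a < w p \<and> w p < b}"
    and bounds: "AE p in M. \<alpha> * u p \<le> w p \<and> w p \<le> u p \<and> u p \<le> 1"
    and w0: "AE p in M. 0 < w p"
    and pairs: "AE p in M. AE q in M. u p = u q \<or> u p \<le> \<alpha> * u q \<or> u q \<le> \<alpha> * u p"
  shows "AE p in M. \<exists>i. u p = \<alpha> ^ i"
proof -
  have step: "AE q in M. (\<exists>i<n. u q = \<alpha> ^ i) \<or> u q \<le> \<alpha> ^ n" for n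
  proof (induction n)
    case 0
    show ?case using bounds by eventually_elim auto
  next
    case (Suc n)
    have "AE q in M. (\<exists>i<n. u q = \<alpha> ^ i) \<or> (c \<le> u q \<and> u q \<le> \<alpha> ^ n) \<or> u q \<le> \<alpha> ^ Suc n"
      if c: "\<alpha> ^ Suc n < c" "c < \<alpha> ^ n" for c
    proof -
      have "\<alpha> ^ n \<le> 1" "0 < \<alpha> ^ n" using \<alpha> by (auto intro: power_le_one)
      then have c0: "0 \<le> c" using c \<alpha> by (smt (verit) zero_less_power)
      \<comment> \<open>The strip \<open>c < w p < \<alpha> ^ n\<close> has positive probability, so
        it meets the almost sure event on which all the other conditions hold.\<close>
      have "\<exists>p. c < w p \<and> w p < \<alpha> ^ n \<and> \<alpha> * u p \<le> w p \<and> w p \<le> u p \<and>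
          ((\<exists>i<n. u p = \<alpha> ^ i) \<or> u p \<le> \<alpha> ^ n) \<and>
          (AE q in M. u p = u q \<or> u p \<le> \<alpha> * u q \<or> u q \<le> \<alpha> * u p)"
      proof (rule ccontr)
        assume neg: "\<not> ?thesis"
        have "AE p in M. \<not> (c < w p \<and> w p < \<alpha> ^ n)"
          using bounds Suc.IH pairs by eventually_elim (use neg in blast)
        then have "prob {p \<in> space M. c < w p \<and> w p < \<alpha> ^ n} = 0"
          by (subst prob_eq_0) auto
        with pos[OF c0 c(2) \<open>\<alpha> ^ n \<le> 1\<close>] show False by simp
      qed
      then obtain p where p: "c < w p" "w p < \<alpha> ^ n" "\<alpha> * u p \<le> w p" "w p \<le> u p"
          "(\<exists>i<n. u p = \<alpha> ^ i) \<or> u p \<le> \<alpha> ^ n"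
        and AEq: "AE q in M. u p = u q \<or> u p \<le> \<alpha> * u q \<or> u q \<le> \<alpha> * u p" by blast
      \<comment> \<open>An earlier level \<open>\<alpha> ^ i\<close> with \<open>i < n\<close> is
        impossible: it would give
        \<open>w p \<ge> \<alpha> * u p \<ge> \<alpha> ^ n\<close>.\<close>
      have "u p \<le> \<alpha> ^ n"
      proof (rule ccontr)
        assume "\<not> u p \<le> \<alpha> ^ n"
        with p(5) obtain i where i: "i < n" "u p = \<alpha> ^ i" by blast
        then have "\<alpha> ^ n \<le> \<alpha> ^ Suc i" using \<alpha> by (intro power_decreasing) auto
        with i p show False by simp
      qed
      then have up: "\<alpha> * u p \<le> \<alpha> ^ Suc n" using \<alpha> by simp
      show ?thesis using AEq Suc.IH
      proof eventually_elim
        case (elim q)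
        show ?case
        proof (cases "\<exists>i<n. u q = \<alpha> ^ i")
          case False
          then have uq: "u q \<le> \<alpha> ^ n" using elim by blast
          then have "\<alpha> * u q \<le> \<alpha> ^ Suc n" using \<alpha> by simp
          then show ?thesis using elim(1) uq up p c \<open>u p \<le> \<alpha> ^ n\<close> by fastforce
        qed blast
      qed
    qed
    \<comment> \<open>A sequence tending to \<open>\<alpha> ^ n\<close> from below; the shift by 2
      keeps every term strictly above \<open>\<alpha> ^ Suc n\<close>. Countably many lower bounds
      can hold simultaneously almost everywhere.\<close>
    moreover define c where "c m = \<alpha> ^ n - (\<alpha> ^ n - \<alpha> ^ Suc n) / real (m + 2)" for m :: nat
    moreover have lt: "\<alpha> ^ Suc n < \<alpha> ^ n" using \<alpha> by simp
    moreover have "\<alpha> ^ Suc n < c m \<and> c m < \<alpha> ^ n" for m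
    proof -
      define d where "d = \<alpha> ^ n - \<alpha> ^ Suc n"
      have "0 < d" using lt by (simp add: d_def)
      then have "0 < d / real (m + 2)" "d / real (m + 2) < d"
        by (simp_all add: divide_less_eq)
      then show ?thesis unfolding c_def d_def[symmetric] by (simp add: d_def)
    qed
    ultimately have "AE q in M. \<forall>m. (\<exists>i<n. u q = \<alpha> ^ i) \<or> (c m \<le> u q \<and> u q \<le> \<alpha> ^ n) \<or> u q \<le> \<alpha> ^ Suc n"
      by (subst AE_all_countable) blast
    then show ?case
    proof eventually_elim
      case (elim q)
      show ?case
      proof (cases "(\<exists>i<n. u q = \<alpha> ^ i) \<or> u q \<le> \<alpha> ^ Suc n")
        case False
        with elim have "c m \<le> u q" "u q \<le> \<alpha> ^ n" for m by blast+
        moreover have "c \<longlonglongrightarrow> \<alpha> ^ n"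
          unfolding c_def by real_asymp
        ultimately have "u q = \<alpha> ^ n" by (intro antisym LIMSEQ_le_const2) auto
        then show ?thesis by auto
      qed (auto simp: less_Suc_eq)
    qed
  qed
  then have "AE q in M. \<forall>n. (\<exists>i<n. u q = \<alpha> ^ i) \<or> u q \<le> \<alpha> ^ n"
    by (subst AE_all_countable) blast
  \<comment> \<open>Since \<open>u\<close> is positive, \<open>u q \<le> \<alpha> ^ n\<close> fails
    for large \<open>n\<close>, and only the levels remain.\<close>
  then show ?thesis using bounds w0
  proof eventually_elim
    case (elim q)
    then have "0 < u q" by simp
    then obtain n where "\<alpha> ^ n < u q" using real_arch_pow_inv \<alpha> by blast
    with elim show ?case by (meson not_le)
  qed
qed

subsection \<open>Permutons\<close>

lemma space_permuton: "permuton \<mu> \<Longrightarrow> space \<mu> = unit_square"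
  by (auto simp: permuton_def square_borel_def space_restrict_space dest!: sets_eq_imp_space_eq)

lemma unit_square_borel [measurable]: "unit_square \<in> sets borel"
  unfolding unit_square_def by (intro borel_closed closed_Times) auto

lemma borel_measurable_square_borel:
  assumes "sets \<mu> = sets square_borel" "f \<in> borel_measurable borel"
  shows "f \<in> borel_measurable \<mu>"
proof -
  have "f \<in> borel_measurable square_borel"
    unfolding square_borel_def by (intro measurable_restrict_space1 assms)
  then show ?thesis using assms(1) by (simp cong: measurable_cong_sets)
qed

lemma permuton_measure_le:
  assumes "permuton \<mu>" "0 \<le> c" "c \<le> 1"
  shows "measure \<mu> {q \<in> space \<mu>. fst q \<le> c} = c" "measure \<mu> {q \<in> space \<mu>. snd q \<le> c} = c"
    "AE q in \<mu>. fst q \<noteq> c" "AE q in \<mu>. snd q \<noteq> c"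
proof -
  interpret prob_space \<mu> using assms by (simp add: permuton_def)
  have [measurable]: "fst \<in> borel_measurable \<mu>" "snd \<in> borel_measurable \<mu>"
    using assms by (auto simp: permuton_def intro!: borel_measurable_square_borel borel_measurable_continuous_onI
        continuous_intros)
  have eq: "{q \<in> space \<mu>. fst q \<le> c} = {0..c} \<times> {0..1}" "{q \<in> space \<mu>. snd q \<le> c} = {0..1} \<times> {0..c}"
    "{q \<in> space \<mu>. fst q = c} = {c..c} \<times> {0..1}" "{q \<in> space \<mu>. snd q = c} = {0..1} \<times> {c..c}"
    using assms(2,3) by (auto simp: space_permuton[OF assms(1)] unit_square_def)
  show "measure \<mu> {q \<in> space \<mu>. fst q \<le> c} = c" "measure \<mu> {q \<in> space \<mu>. snd q \<le> c} = c"
    using assms unfolding eq by (simp_all add: permuton_def)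
  have "prob ({c..c} \<times> {0..1}) = c - c" "prob ({0..1} \<times> {c..c}) = c - c"
    using assms unfolding permuton_def by blast+
  then have "prob {q \<in> space \<mu>. fst q = c} = 0" "prob {q \<in> space \<mu>. snd q = c} = 0"
    unfolding eq by simp_all
  then show "AE q in \<mu>. fst q \<noteq> c" "AE q in \<mu>. snd q \<noteq> c"
    using prob_eq_0[of "{q \<in> space \<mu>. fst q = c}"] prob_eq_0[of "{q \<in> space \<mu>. snd q = c}"]
    by simp_all
qed

lemma permuton_atomless:
  assumes "permuton \<mu>"
  shows "atomless_plane_prob_space \<mu>"
proof -
  interpret prob_space \<mu> using assms by (simp add: permuton_def)
  show ?thesis
  proof
    show "fst \<in> borel_measurable \<mu>" "snd \<in> borel_measurable \<mu>"
      using assms by (auto simp: permuton_def intro!: borel_measurable_square_borel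
          borel_measurable_continuous_onI continuous_intros)
    fix c :: real
    have "AE q in \<mu>. q \<in> unit_square"
      using AE_space[of \<mu>] unfolding space_permuton[OF assms] .
    then have out: "AE q in \<mu>. fst q \<noteq> c \<and> snd q \<noteq> c" if "\<not> (0 \<le> c \<and> c \<le> 1)"
      by eventually_elim (use that in \<open>auto simp: unit_square_def\<close>)
    show "AE q in \<mu>. fst q \<noteq> c"
      using permuton_measure_le(3)[OF assms] out by (cases "0 \<le> c \<and> c \<le> 1") auto
    show "AE q in \<mu>. snd q \<noteq> c"
      using permuton_measure_le(4)[OF assms] out by (cases "0 \<le> c \<and> c \<le> 1") auto
  qed
qed

locale permuton_space =
  fixes \<mu> :: "(real \<times> real) measure"
  assumes permuton: "permuton \<mu>"

sublocale permuton_space \<subseteq> atomless_plane_prob_space \<mu>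
  by (rule permuton_atomless[OF permuton])

context permuton_space begin

section \<open>Masses of half planes and quadrants\<close>

lemma prob_fst_le: "0 \<le> c \<Longrightarrow> c \<le> 1 \<Longrightarrow> prob {q \<in> space \<mu>. fst q \<le> c} = c"
  and prob_snd_le: "0 \<le> c \<Longrightarrow> c \<le> 1 \<Longrightarrow> prob {q \<in> space \<mu>. snd q \<le> c} = c"
  using permuton_measure_le[OF permuton] by auto

lemma prob_fst_less: "0 \<le> c \<Longrightarrow> c \<le> 1 \<Longrightarrow> prob {q \<in> space \<mu>. fst q < c} = c"
  using fst_atomless[of c] by (subst prob_fst_le[symmetric, of c], simp_all)
    (intro finite_measure_eq_AE, auto elim!: eventually_mono)

lemma prob_fst_greater: "0 \<le> c \<Longrightarrow> c \<le> 1 \<Longrightarrow> prob {q \<in> space \<mu>. c < fst q} = 1 - c"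
  using prob_neg[of "\<lambda>q. fst q \<le> c"] by (simp add: not_le prob_fst_le)

lemma prob_snd_greater: "0 \<le> c \<Longrightarrow> c \<le> 1 \<Longrightarrow> prob {q \<in> space \<mu>. c < snd q} = 1 - c"
  using prob_neg[of "\<lambda>q. snd q \<le> c"] by (simp add: not_le prob_snd_le)

lemma prob_fst_strip:
  assumes "0 \<le> a" "a < b" "b \<le> 1"
  shows "0 < prob {p \<in> space \<mu>. a < 1 - fst p \<and> 1 - fst p < b}"
proof -
  have "prob {q \<in> space \<mu>. fst q < 1 - a} =
      prob ({p \<in> space \<mu>. a < 1 - fst p \<and> 1 - fst p < b} \<union> {q \<in> space \<mu>. fst q \<le> 1 - b})"
    using assms by (intro arg_cong[where f = prob]) auto
  also have "\<dots> \<le> prob {p \<in> space \<mu>. a < 1 - fst p \<and> 1 - fst p < b} + prob {q \<in> space \<mu>. fst q \<le> 1 - b}"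
    by (intro measure_Un_le) auto
  finally show ?thesis using assms by (simp add: prob_fst_less prob_fst_le)
qed

lemma below_le_fst:
  assumes "p \<in> space \<mu>"
  shows "below p \<le> fst p"
proof -
  have "0 \<le> fst p" "fst p \<le> 1" using assms by (auto simp: space_permuton[OF permuton] unit_square_def)
  then have "fst p = prob {q \<in> space \<mu>. fst q < fst p}" by (simp add: prob_fst_less)
  also have "\<dots> \<ge> below p" unfolding below_def by (intro finite_measure_mono) (auto simp: sw_def)
  finally show ?thesis .
qed

lemma above_le_fst:
  assumes "p \<in> space \<mu>"
  shows "above p \<le> 1 - fst p"
proof -
  have "0 \<le> fst p" "fst p \<le> 1" using assms by (auto simp: space_permuton[OF permuton] unit_square_def)
  then have "1 - fst p = prob {q \<in> space \<mu>. fst p < fst q}" by (simp add: prob_fst_greater)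
  also have "\<dots> \<ge> above p" unfolding above_def by (intro finite_measure_mono) (auto simp: sw_def)
  finally show ?thesis .
qed

text \<open>Both sides are the mass of the north-west quadrant of \<open>p\<close>.\<close>

lemma fst_minus_below:
  assumes "p \<in> space \<mu>"
  shows "fst p - below p = 1 - snd p - above p"
proof -
  let ?N = "{q \<in> space \<mu>. fst q < fst p \<and> snd p \<le> snd q}"
  have p: "0 \<le> fst p" "fst p \<le> 1" "0 \<le> snd p" "snd p \<le> 1"
    using assms by (auto simp: space_permuton[OF permuton] unit_square_def)
  have "fst p = prob {q \<in> space \<mu>. fst q < fst p}" using p by (simp add: prob_fst_less)
  also have "\<dots> = prob ({q \<in> space \<mu>. sw q p} \<union> ?N)"
    by (intro arg_cong[where f = prob]) (auto simp: sw_def)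
  also have "\<dots> = below p + prob ?N"
    unfolding below_def by (intro finite_measure_Union) (auto simp: sw_def)
  finally have 1: "fst p - below p = prob ?N" by simp
  have "1 - snd p = prob {q \<in> space \<mu>. snd p < snd q}" using p by (simp add: prob_snd_greater)
  also have "\<dots> = prob ({q \<in> space \<mu>. sw p q} \<union> ?N)"
  \<comment> \<open>The two sets differ only on the vertical and horizontal lines through
    \<open>p\<close>, which are null.\<close>
  proof (rule finite_measure_eq_AE)
    show "AE q in \<mu>. (q \<in> {q \<in> space \<mu>. snd p < snd q}) = (q \<in> {q \<in> space \<mu>. sw p q} \<union> ?N)"
      using fst_atomless[of "fst p"] snd_atomless[of "snd p"] AE_space
      by eventually_elim (auto simp: sw_def)
  qed auto
  also have "\<dots> = above p + prob ?N"
    unfolding above_def by (intro finite_measure_Union) (auto simp: sw_def)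
  finally show ?thesis using 1 by simp
qed

text \<open>If \<open>p\<close> is below \<open>q\<close>, almost every third point is above
  \<open>p\<close> or below \<open>q\<close>, hence the bound on masses. If they are incomparable,
  almost the same points lie below both. With \<open>above = \<alpha> * (1 - below)\<close>, the
  last two alternatives become a ratio of at least \<open>1 / \<alpha>\<close> between the values of
  \<open>1 - below\<close>.\<close>

lemma weakly_ordered_below:
  assumes "AE \<omega> in samples 3. weakly_ordered 3 \<omega>"
  shows "AE p in \<mu>. AE q in \<mu>. below p = below q \<or> 1 - above p \<le> below q \<or> 1 - above q \<le> below p"
proof -
  let ?P = "\<lambda>p q r. (sw p q \<longrightarrow> sw p r \<or> sw r q) \<and> (sw q p \<longrightarrow> sw q r \<or> sw r p) \<and>
      (sw r p \<longrightarrow> sw r q \<or> sw q p) \<and> (sw r q \<longrightarrow> sw r p \<or> sw p q)"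
  have "AE \<omega> in samples 3. ?P (\<omega> 0) (\<omega> 1) (\<omega> 2)"
    using assms by eventually_elim (auto simp: weakly_ordered_def)
  then have triple: "AE p in \<mu>. AE q in \<mu>. AE r in \<mu>. ?P p q r" by (rule AE_samples_3D)
  have pair: "below p = below q \<or> 1 - above p \<le> below q \<or> 1 - above q \<le> below p"
    if r: "AE r in \<mu>. ?P p q r" for p q
  proof -
    have *: "1 - above p = prob {r \<in> space \<mu>. \<not> sw p r}" for p
      unfolding above_def by (subst prob_neg) auto
    consider "sw p q" | "sw q p" | "\<not> sw p q" "\<not> sw q p" by blast
    then show ?thesis
    proof cases
      case 1
      have "1 - above p \<le> below q"
        unfolding * below_def 
        by (rule finite_measure_mono_AE) (rule eventually_mono[OF r], use 1 in auto)
      then show ?thesis by simp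
    next
      case 2
      have "1 - above q \<le> below p"
        unfolding * below_def 
        by (rule finite_measure_mono_AE) (rule eventually_mono[OF r], use 2 in auto)
      then show ?thesis by simp
    next
      case 3
      have "below p = below q"
        unfolding below_def 
        by (rule finite_measure_eq_AE) (rule eventually_mono[OF r], use 3 in auto)
      then show ?thesis by simp
    qed
  qed
  show ?thesis
  proof (rule eventually_mono[OF triple])
    fix p assume "AE q in \<mu>. AE r in \<mu>. ?P p q r"
    then show "AE q in \<mu>. below p = below q \<or> 1 - above p \<le> below q \<or> 1 - above q \<le> below p"
      by (rule eventually_mono) (rule pair)
  qed
qed

section \<open>From the two order conditions to the graph of \<open>layer\<close>\<close>

lemma AE_snd_eq_layer:
  assumes \<alpha>: "0 < \<alpha>" "\<alpha> < 1"
    and wo: "AE \<omega> in samples 3. weakly_ordered 3 \<omega>"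
    and ab: "AE p in \<mu>. above p = \<alpha> * (1 - below p)"
  shows "AE p in \<mu>. snd p = layer \<alpha> (fst p)"
proof -
  have bounds: "AE p in \<mu>. \<alpha> * (1 - below p) \<le> 1 - fst p \<and> 1 - fst p \<le> 1 - below p \<and> 1 - below p \<le> 1"
    using ab AE_space
  proof eventually_elim
    case (elim p)
    then show ?case using below_le_fst[of p] above_le_fst[of p] by (auto simp: below_def)
  qed
  have w0: "AE p in \<mu>. 0 < 1 - fst p"
    using fst_atomless[of 1] AE_space
    by eventually_elim (auto simp: space_permuton[OF permuton] unit_square_def)
  have "AE p in \<mu>. AE q in \<mu>. 1 - below p = 1 - below q \<or> 1 - below p \<le> \<alpha> * (1 - below q) \<or>
      1 - below q \<le> \<alpha> * (1 - below p)"
    using weakly_ordered_below[OF wo] ab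
  proof eventually_elim
    case (elim p)
    show ?case using elim(1) ab by eventually_elim (use elim(2) in auto)
  qed
  then have "AE p in \<mu>. \<exists>i. 1 - below p = \<alpha> ^ i"
    by (intro AE_geometric_levels[OF \<alpha> _ _ bounds w0]) (auto intro: prob_fst_strip)
  \<comment> \<open>Excludes the block boundaries, where the bound
    \<open>\<alpha> * u \<le> 1 - fst p\<close> is not strict and \<open>block_top\<close> would
    pick the next level.\<close>
  moreover have "AE p in \<mu>. \<forall>i. fst p \<noteq> 1 - \<alpha> ^ i"
    using fst_atomless by (subst AE_all_countable) auto
  ultimately show ?thesis using bounds ab AE_space
  proof eventually_elim
    case (elim p)
    then obtain i where i: "1 - below p = \<alpha> ^ i" by blast
    have "fst p \<noteq> 1 - \<alpha> ^ Suc i" using elim(2) by blast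
    then have "block_top \<alpha> (1 - fst p) = \<alpha> ^ i"
      using elim(3) i by (intro block_top_eqI[OF \<alpha>]) (auto simp: less_le)
    \<comment> \<open>With \<open>u = 1 - below p\<close>, the quadrant identity reads
      \<open>snd p = 1 - \<alpha> * u - fst p + (1 - u)\<close>.\<close>
    then show ?case
      using fst_minus_below[OF elim(5)] elim(4) i by (simp add: layer_def algebra_simps)
  qed
qed

end

text \<open>On a graph the mass of \<open>B\<close> is the mass of
  \<open>{x. (x, h x) \<in> B}\<close> under the first marginal, and that marginal is uniform for
  every permuton.\<close>

lemma permuton_graph_unique:
  assumes "permuton \<mu>" "permuton \<mu>'" and h [measurable]: "h \<in> borel_measurable borel"
    and "AE p in \<mu>. snd p = h (fst p)" "AE p in \<mu>'. snd p = h (fst p)"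
  shows "\<mu> = \<mu>'"
proof -
  interpret \<mu>: permuton_space \<mu> by standard fact
  interpret \<mu>': permuton_space \<mu>' by standard fact
  have marginal: "distr \<mu> borel fst = distr \<mu>' borel fst"
  proof (rule cdf_unique)
    show "real_distribution (distr \<mu> borel fst)" "real_distribution (distr \<mu>' borel fst)"
      by (auto simp: real_distribution_def real_distribution_axioms_def intro: \<mu>.prob_space_distr \<mu>'.prob_space_distr)
    show "cdf (distr \<mu> borel fst) = cdf (distr \<mu>' borel fst)"
    proof
      fix c :: real
      have *: "cdf (distr \<nu> borel fst) c = (if c < 0 then 0 else if c \<le> 1 then c else 1)" if "permuton_space \<nu>" for \<nu>
      proof -
        interpret permuton_space \<nu> by fact
        have "cdf (distr \<nu> borel fst) c = prob {q \<in> space \<nu>. fst q \<le> c}"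
          unfolding cdf_def by (subst measure_distr) (auto intro!: arg_cong[where f = prob])
        moreover have "prob {q \<in> space \<nu>. fst q \<le> c} = prob {}" if "c < 0"
          using that by (intro arg_cong[where f = prob]) (auto simp: space_permuton[OF permuton] unit_square_def)
        moreover have "prob {q \<in> space \<nu>. fst q \<le> c} = prob (space \<nu>)" if "c > 1"
          using that by (intro arg_cong[where f = prob]) (auto simp: space_permuton[OF permuton] unit_square_def)
        ultimately show ?thesis using prob_fst_le[of c] by (auto simp: prob_space)
      qed
      show "cdf (distr \<mu> borel fst) c = cdf (distr \<mu>' borel fst) c"
        by (simp add: * \<mu>.permuton_space_axioms \<mu>'.permuton_space_axioms)
    qed
  qed
  show ?thesis
  proof (rule measure_eqI)
    show sets: "sets \<mu> = sets \<mu>'" using assms by (simp add: permuton_def)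
    fix B assume B: "B \<in> sets \<mu>"
    then have "B \<in> sets square_borel" using assms by (simp add: permuton_def)
    then have B' [measurable]: "B \<in> sets borel"
      by (auto simp: square_borel_def sets_restrict_space)
    have graph: "emeasure \<nu> B = emeasure (distr \<nu> borel fst) {x. (x, h x) \<in> B}"
      if \<nu>: "permuton_space \<nu>" "AE p in \<nu>. snd p = h (fst p)" for \<nu>
    proof -
      interpret permuton_space \<nu> by fact
      have "B \<in> events" using \<open>B \<in> sets square_borel\<close> permuton by (simp add: permuton_def)
      have [measurable]: "{x. (x, h x) \<in> B} \<in> sets borel"
        using measurable_sets[of "\<lambda>x. (x, h x)" borel borel B] by (simp add: vimage_def)
      have "emeasure \<nu> B = emeasure \<nu> (fst -` {x. (x, h x) \<in> B} \<inter> space \<nu>)"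
        using \<nu>(2) AE_space
      proof (intro emeasure_eq_AE)
        show "AE p in \<nu>. (p \<in> B) = (p \<in> fst -` {x. (x, h x) \<in> B} \<inter> space \<nu>)"
          using \<nu>(2) AE_space by eventually_elim (metis IntI Int_iff mem_Collect_eq prod.collapse vimage_eq)
      qed (use \<open>B \<in> events\<close> in auto)
      then show ?thesis by (simp add: emeasure_distr)
    qed
    show "emeasure \<mu> B = emeasure \<mu>' B"
      using graph[OF \<mu>.permuton_space_axioms] graph[OF \<mu>'.permuton_space_axioms] assms marginal by simp
  qed
qed

subsection \<open>The permuton \<open>mu_m\<close>\<close>

context
  fixes \<alpha> :: real
  assumes \<alpha>: "0 < \<alpha>" "\<alpha> < 1"
begin

abbreviation corner :: "nat \<Rightarrow> real" where
  "corner i \<equiv> 1 - \<alpha> ^ i"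

lemma corner_mono: "corner i < corner (Suc i)"
  using \<alpha> by simp

section \<open>Marginals of the segments and of their mixture\<close>

lemma uniform_on_antidiagonal:
  assumes "z \<le> z'"
  shows "uniform_on_segment (antidiagonal z z') =
    distr (uniform_measure lborel {0..1}) borel (\<lambda>t. (z + t * (z' - z), z' - t * (z' - z)))"
  unfolding antidiagonal_eq_closed_segment[OF assms] uniform_on_segment_closed_segment
  by (intro arg_cong[where f = "distr _ _"]) (auto simp: fun_eq_iff algebra_simps)

lemma emeasure_antidiagonal:
  assumes "z \<le> z'" and B: "B \<in> sets borel"
  shows "emeasure (uniform_on_segment (antidiagonal z z')) B =
    emeasure lborel ({0..1} \<inter> (\<lambda>t. (z + t * (z' - z), z' - t * (z' - z))) -` B)"
proof -
  let ?f = "\<lambda>t. (z + t * (z' - z), z' - t * (z' - z))"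
  have f: "?f \<in> borel \<rightarrow>\<^sub>M borel"
    by (intro borel_measurable_continuous_onI continuous_intros)
  have "?f -` B \<in> sets lborel" using measurable_sets[OF f B] by simp
  then show ?thesis
    unfolding uniform_on_antidiagonal[OF assms(1)] using f B
    by (subst emeasure_distr) (auto simp: divide_ennreal_def)
qed

lemma uniform_on_antidiagonal_strip:
  assumes z: "0 \<le> z" "z < z'" "z' \<le> 1"
  shows "ennreal (z' - z) * emeasure (uniform_on_segment (antidiagonal z z')) ({a..b} \<times> {0..1}) =
      emeasure lborel ({z..z'} \<inter> {a..b})"
    and "ennreal (z' - z) * emeasure (uniform_on_segment (antidiagonal z z')) ({0..1} \<times> {a..b}) =
      emeasure lborel ({z..z'} \<inter> {a..b})"
proof -
  \<comment> \<open>The slope may have either sign: the first coordinate of the segment increases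
    with \<open>t\<close>, the second decreases.\<close>
  have aff: "emeasure lborel A = ennreal \<bar>c\<bar> * emeasure lborel ((\<lambda>t. s + c * t) -` A)"
    if "c \<noteq> 0" "A \<in> sets borel" for s c :: real and A
    using that by (subst lborel_real_affine[of c s]) (auto simp: emeasure_density nn_integral_cmult emeasure_distr nn_integral_distr vimage_def)
  have in01: "z + t * (z' - z) \<in> {z..z'}" "z' - t * (z' - z) \<in> {z..z'}" if "t \<in> {0..1}" for t
  proof -
    define s where "s = t * (z' - z)"
    have "0 \<le> s" "s \<le> z' - z"
      unfolding s_def using that z mult_right_mono[of t 1 "z' - z"] by auto
    then show "z + t * (z' - z) \<in> {z..z'}" "z' - t * (z' - z) \<in> {z..z'}"
      unfolding s_def[symmetric] by auto
  qed
  have pos: "z' - z > 0" using z by simp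
  have iff: "z + t * (z' - z) \<in> {z..z'} \<longleftrightarrow> t \<in> {0..1}" "z' - t * (z' - z) \<in> {z..z'} \<longleftrightarrow> t \<in> {0..1}" for t
  proof -
    define s where "s = t * (z' - z)"
    have "0 \<le> s \<longleftrightarrow> 0 \<le> t" "s \<le> z' - z \<longleftrightarrow> t \<le> 1"
      unfolding s_def using mult_le_cancel_right_pos[OF pos, of t 1] mult_le_cancel_right_pos[OF pos, of 0 t]
      by simp_all
    then show "z + t * (z' - z) \<in> {z..z'} \<longleftrightarrow> t \<in> {0..1}" "z' - t * (z' - z) \<in> {z..z'} \<longleftrightarrow> t \<in> {0..1}"
      unfolding s_def[symmetric] by auto
  qed
  have sub: "{z..z'} \<subseteq> {0..1}" using z by auto
  have meas: "{a..b} \<times> {0..1} \<in> sets (borel :: (real \<times> real) measure)" "{0..1} \<times> {a..b} \<in> sets (borel :: (real \<times> real) measure)"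
    by (auto intro!: borel_closed closed_Times)
  have "emeasure lborel ({z..z'} \<inter> {a..b}) =
      ennreal (z' - z) * emeasure lborel ((\<lambda>t. z + t * (z' - z)) -` ({z..z'} \<inter> {a..b}))"
    using aff[of "z' - z" "{z..z'} \<inter> {a..b}" z] z by (simp add: mult.commute)
  also have "(\<lambda>t. z + t * (z' - z)) -` ({z..z'} \<inter> {a..b}) =
      {0..1} \<inter> (\<lambda>t. (z + t * (z' - z), z' - t * (z' - z))) -` ({a..b} \<times> {0..1})"
    using in01 iff sub
    by (intro set_eqI) (simp only: vimage_eq Int_iff mem_Times_iff fst_conv snd_conv, blast)
  also have "emeasure lborel \<dots> = emeasure (uniform_on_segment (antidiagonal z z')) ({a..b} \<times> {0..1})"
    using z meas(1) by (subst emeasure_antidiagonal) auto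
  finally show "ennreal (z' - z) * emeasure (uniform_on_segment (antidiagonal z z')) ({a..b} \<times> {0..1}) =
      emeasure lborel ({z..z'} \<inter> {a..b})" ..
  have "emeasure lborel ({z..z'} \<inter> {a..b}) =
      ennreal (z' - z) * emeasure lborel ((\<lambda>t. z' - t * (z' - z)) -` ({z..z'} \<inter> {a..b}))"
    using aff[of "z - z'" "{z..z'} \<inter> {a..b}" z'] z by (simp add: algebra_simps)
  also have "(\<lambda>t. z' - t * (z' - z)) -` ({z..z'} \<inter> {a..b}) =
      {0..1} \<inter> (\<lambda>t. (z + t * (z' - z), z' - t * (z' - z))) -` ({0..1} \<times> {a..b})"
    using in01 iff sub
    by (intro set_eqI) (simp only: vimage_eq Int_iff mem_Times_iff fst_conv snd_conv, blast)
  also have "emeasure lborel \<dots> = emeasure (uniform_on_segment (antidiagonal z z')) ({0..1} \<times> {a..b})"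
    using z meas(2) by (subst emeasure_antidiagonal) auto
  finally show "ennreal (z' - z) * emeasure (uniform_on_segment (antidiagonal z z')) ({0..1} \<times> {a..b}) =
      emeasure lborel ({z..z'} \<inter> {a..b})" ..
qed

lemma corner_blocks: "(\<Union>i. {corner i..<corner (Suc i)}) = {0..<1}"
proof (intro equalityI subsetI)
  fix x assume "x \<in> (\<Union>i. {corner i..<corner (Suc i)})"
  then obtain i where "corner i \<le> x" "x < corner (Suc i)" by auto
  moreover have "\<alpha> ^ i \<le> 1" "0 < \<alpha> ^ Suc i" using \<alpha> by (auto simp: power_le_one)
  ultimately show "x \<in> {0..<1}" unfolding atLeastLessThan_iff by linarith
next
  fix x :: real assume "x \<in> {0..<1}"
  then obtain i where "\<alpha> * \<alpha> ^ i < 1 - x" "1 - x \<le> \<alpha> ^ i"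
    using block_exists[OF \<alpha>, of "1 - x"] by auto
  then have "x \<in> {corner i..<corner (Suc i)}" by simp
  then show "x \<in> (\<Union>i. {corner i..<corner (Suc i)})" by blast
qed

text \<open>Closed blocks share endpoints, which are null; dropping the right ones leaves a disjoint
  tiling of the unit interval without 1.\<close>

lemma suminf_block_intervals:
  assumes "0 \<le> a" "a \<le> b" "b \<le> 1"
  shows "(\<Sum>i. emeasure lborel ({corner i..corner (Suc i)} \<inter> {a..b})) = ennreal (b - a)"
proof -
  have "(\<Sum>i. emeasure lborel ({corner i..corner (Suc i)} \<inter> {a..b})) =
      (\<Sum>i. emeasure lborel ({corner i..<corner (Suc i)} \<inter> {a..b}))"
  proof (intro suminf_cong emeasure_eq_AE)
    fix i
    show "AE x in lborel. (x \<in> {corner i..corner (Suc i)} \<inter> {a..b}) = (x \<in> {corner i..<corner (Suc i)} \<inter> {a..b})"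
      using AE_lborel_singleton[of "corner (Suc i)"] by eventually_elim auto
  qed auto
  also have "\<dots> = emeasure lborel (\<Union>i. {corner i..<corner (Suc i)} \<inter> {a..b})"
  proof (intro suminf_emeasure)
    have disj: "{corner m..<corner (Suc m)} \<inter> {corner n..<corner (Suc n)} = {}" if "m < n" for m n
    proof -
      have "\<alpha> ^ n \<le> \<alpha> ^ Suc m" using that \<alpha> by (intro power_decreasing) auto
      then show ?thesis by auto
    qed
    show "disjoint_family (\<lambda>i. {corner i..<corner (Suc i)} \<inter> {a..b})"
      unfolding disjoint_family_on_def
    proof (intro ballI impI)
      fix m n :: nat assume "m \<noteq> n"
      then show "{corner m..<corner (Suc m)} \<inter> {a..b} \<inter> ({corner n..<corner (Suc n)} \<inter> {a..b}) = {}"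
        using disj[of m n] disj[of n m] by (cases m n rule: linorder_cases) blast+
    qed
  qed auto
  also have "(\<Union>i. {corner i..<corner (Suc i)} \<inter> {a..b}) = {0..<1} \<inter> {a..b}"
    using corner_blocks by auto
  also have "emeasure lborel \<dots> = emeasure lborel {a..b}"
  proof (intro emeasure_eq_AE)
    show "AE x in lborel. (x \<in> {0..<1} \<inter> {a..b}) = (x \<in> {a..b})"
      using AE_lborel_singleton[of 1] by eventually_elim (use assms in auto)
  qed auto
  finally show ?thesis using assms by simp
qed

lemma permuton_mu_m: "permuton (mu_m \<alpha>)"
proof -
  have strip: "{a..b} \<times> {0..1} \<in> sets square_borel" "{0..1} \<times> {a..b} \<in> sets square_borel"
    if "0 \<le> a" "b \<le> 1" for a b :: real
    using that unfolding square_borel_def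
    by (subst sets_restrict_space_iff; auto simp: unit_square_def intro!: borel_closed closed_Times)+
  \<comment> \<open>The weight of a segment is the length of its block; this is why both marginals
    come out uniform.\<close>
  have len: "(1 - \<alpha>) * \<alpha> ^ i = corner (Suc i) - corner i" for i by (simp add: algebra_simps)
  have corner01: "0 \<le> corner i" "corner i \<le> 1" for i using \<alpha> by (auto simp: power_le_one)
  note s = uniform_on_antidiagonal_strip[OF corner01(1) corner_mono corner01(2)]
  have em: "emeasure (mu_m \<alpha>) ({a..b} \<times> {0..1}) = ennreal (b - a)"
    "emeasure (mu_m \<alpha>) ({0..1} \<times> {a..b}) = ennreal (b - a)" if "0 \<le> a" "a \<le> b" "b \<le> 1" for a b
    using that by (simp_all only: emeasure_mu_m strip len s suminf_block_intervals)
  have "space (mu_m \<alpha>) = {0..1} \<times> {0..1}"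
    using sets_eq_imp_space_eq[OF sets_mu_m, of \<alpha>]
    by (simp add: square_borel_def space_restrict_space unit_square_def)
  then have "prob_space (mu_m \<alpha>)" using em(1)[of 0 1] by (intro prob_spaceI) simp
  then show ?thesis using em by (auto simp: permuton_def measure_def)
qed

section \<open>Order structure of \<open>mu_m\<close>\<close>

lemma AE_mu_m: "AE p in mu_m \<alpha>. snd p = layer \<alpha> (fst p)"
proof -
  interpret permuton_space "mu_m \<alpha>" by standard (rule permuton_mu_m)
  let ?B = "{p \<in> space (mu_m \<alpha>). snd p \<noteq> layer \<alpha> (fst p)}"
  have B: "?B \<in> events" by measurable
  have B': "?B \<in> sets borel"
    using B by (auto simp: square_borel_def sets_restrict_space)
  have "emeasure (uniform_on_segment (antidiagonal (corner i) (corner (Suc i)))) ?B = 0" for i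
  proof -
    let ?f = "\<lambda>t. (corner i + t * (corner (Suc i) - corner i), corner (Suc i) - t * (corner (Suc i) - corner i))"
    have "emeasure (uniform_on_segment (antidiagonal (corner i) (corner (Suc i)))) ?B =
        emeasure lborel ({0..1} \<inter> ?f -` ?B)"
      by (rule emeasure_antidiagonal[OF less_imp_le[OF corner_mono] B'])
    \<comment> \<open>At \<open>t = 1\<close> the first coordinate is already the left end of the
      next block; every other parameter gives a point of the graph.\<close>
    also have "\<dots> \<le> emeasure lborel {1 :: real}"
    proof (intro emeasure_mono subsetI)
      fix t assume t: "t \<in> {0..1} \<inter> ?f -` ?B"
      show "t \<in> {1}"
      proof (rule ccontr)
        assume "t \<notin> {1}"
        with t have t01: "0 \<le> t" "t < 1" by auto
        define d where "d = corner (Suc i) - corner i"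
        have d: "d > 0" using corner_mono[of i] by (simp add: d_def)
        have "0 \<le> t * d" "t * d < d" using t01 d by auto
        then have "block_top \<alpha> (1 - (corner i + t * d)) = \<alpha> ^ i"
          by (intro block_top_eqI[OF \<alpha>]) (auto simp: d_def)
        then have "layer \<alpha> (corner i + t * d) = corner (Suc i) - t * d"
          by (simp add: layer_def algebra_simps)
        with t show False by (simp add: d_def)
      qed
    qed simp
    finally show ?thesis by simp
  qed
  then have "emeasure (mu_m \<alpha>) ?B = 0"
    using B by (subst emeasure_mu_m) auto
  then show ?thesis using B by (subst AE_iff_measurable[OF B refl]) 
qed

lemma AE_mu_m_graph: "AE p in mu_m \<alpha>. 0 \<le> fst p \<and> fst p < 1 \<and> p = (fst p, layer \<alpha> (fst p))"
proof -
  interpret permuton_space "mu_m \<alpha>" by standard (rule permuton_mu_m)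
  show ?thesis
    using AE_mu_m AE_space fst_atomless[of 1]
    by eventually_elim (auto simp: space_permuton[OF permuton_mu_m] unit_square_def prod_eq_iff)
qed

lemma sw_graph_iff:
  assumes "0 \<le> fst p \<and> fst p < 1 \<and> p = (fst p, layer \<alpha> (fst p))"
    and "0 \<le> fst q \<and> fst q < 1 \<and> q = (fst q, layer \<alpha> (fst q))"
  shows "sw p q \<longleftrightarrow> block_top \<alpha> (1 - fst q) < block_top \<alpha> (1 - fst p)"
  using sw_layer_iff[OF \<alpha>, of "fst p" "fst q"] assms by metis

text \<open>On the graph, \<open>sw\<close> compares the real numbers
  \<open>block_top \<alpha> (1 - x)\<close>, and comparison by a real-valued function is a strict
  weak order.\<close>

lemma mu_m_weakly_ordered:
  "AE \<omega> in (\<Pi>\<^sub>M k\<in>{..<n}. mu_m \<alpha>). weakly_ordered n \<omega>"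
proof -
  interpret permuton_space "mu_m \<alpha>" by standard (rule permuton_mu_m)
  have "AE \<omega> in samples n. \<forall>k\<in>{..<n}. 0 \<le> fst (\<omega> k) \<and> fst (\<omega> k) < 1 \<and>
      \<omega> k = (fst (\<omega> k), layer \<alpha> (fst (\<omega> k)))"
    by (intro AE_finite_allI AE_PiM_component AE_mu_m_graph prob_space_axioms) auto
  then show ?thesis
    by eventually_elim (auto simp: weakly_ordered_def sw_graph_iff)
qed

text \<open>For \<open>p\<close> in the block with top \<open>u\<close>, the points below it are
  those of the earlier blocks, of mass \<open>1 - u\<close>, and the points above it are those of
  the later blocks, of mass \<open>\<alpha> * u\<close>.\<close>

lemma mu_m_above:
  "AE p in mu_m \<alpha>. atomless_plane_prob_space.above (mu_m \<alpha>) p =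
     \<alpha> * (1 - atomless_plane_prob_space.below (mu_m \<alpha>) p)"
proof -
  interpret permuton_space "mu_m \<alpha>" by standard (rule permuton_mu_m)
  show ?thesis using AE_mu_m_graph
  proof eventually_elim
    case (elim p)
    define u where "u = block_top \<alpha> (1 - fst p)"
    have u: "0 < u" "u \<le> 1" using block_top_bounds[OF \<alpha>, of "1 - fst p"] elim by (auto simp: u_def)
    then have \<alpha>u: "0 \<le> \<alpha> * u" "\<alpha> * u \<le> 1" using \<alpha> by (auto simp: mult_le_one)
    have "below p = prob {q \<in> space (mu_m \<alpha>). fst q < 1 - u}"
      unfolding below_def
    proof (rule finite_measure_eq_AE)
      show "AE q in mu_m \<alpha>. (q \<in> {q \<in> space (mu_m \<alpha>). sw q p}) = (q \<in> {q \<in> space (mu_m \<alpha>). fst q < 1 - u})"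
        using AE_mu_m_graph
      proof eventually_elim
        case (elim q)
        have "sw q p \<longleftrightarrow> u < 1 - fst q"
          using sw_graph_iff[OF elim \<open>0 \<le> fst p \<and> _\<close>] block_top_less_iff(2)[OF \<alpha>, of "1 - fst p" "1 - fst q"]
            elim \<open>0 \<le> fst p \<and> _\<close> by (simp add: u_def)
        then show ?case by auto
      qed
    qed (auto simp del: sets_mu_m)
    then have below: "below p = 1 - u" using u by (simp add: prob_fst_less)
    have "above p = prob {q \<in> space (mu_m \<alpha>). 1 - \<alpha> * u < fst q}"
      unfolding above_def
    proof (rule finite_measure_eq_AE)
      show "AE q in mu_m \<alpha>. (q \<in> {q \<in> space (mu_m \<alpha>). sw p q}) = (q \<in> {q \<in> space (mu_m \<alpha>). 1 - \<alpha> * u < fst q})"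
        \<comment> \<open>The line \<open>fst q = 1 - \<alpha> * u\<close> is where the later blocks
          begin; it is null and is removed to obtain a strict inequality.\<close>
        using AE_mu_m_graph fst_atomless[of "1 - \<alpha> * u"]
      proof eventually_elim
        case (elim q)
        have "sw p q \<longleftrightarrow> 1 - fst q \<le> \<alpha> * u"
          using sw_graph_iff[OF \<open>0 \<le> fst p \<and> _\<close> elim(1)] block_top_less_iff(1)[OF \<alpha>, of "1 - fst q" "1 - fst p"]
            elim \<open>0 \<le> fst p \<and> _\<close> by (simp add: u_def)
        then show ?case using elim(2) by auto
      qed
    qed (auto simp del: sets_mu_m)
    then show ?case using below \<alpha>u by (simp add: prob_fst_greater)
  qed
qed

end

section \<open>Transfer of the two conditions by densities of order 3\<close>

theorem theorem7:
  fixes \<alpha> :: real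
  assumes "0 < \<alpha>" and "\<alpha> < 1"
  shows "finitely_forcible (mu_m \<alpha>)"
  unfolding finitely_forcible_def
proof (intro conjI exI allI impI)
  show "permuton (mu_m \<alpha>)" using assms by (rule permuton_mu_m)
  then interpret m: permuton_space "mu_m \<alpha>" by unfold_locales
  let ?S = "Pair (3::nat) ` {\<sigma>. \<sigma> permutes {..<3::nat}}"
  show "finite ?S" by (simp add: finite_permutations)
  show "\<forall>(n, \<sigma>)\<in>?S. \<sigma> permutes {..<n}" by auto
  fix \<mu>' assume \<mu>': "permuton \<mu>' \<and> (\<forall>(n, \<sigma>)\<in>?S. perm_density n \<sigma> \<mu>' = perm_density n \<sigma> (mu_m \<alpha>))"
  then interpret permuton_space \<mu>' by unfold_locales simp
  have density: "perm_density 3 \<sigma> \<mu>' = perm_density 3 \<sigma> (mu_m \<alpha>)" if "\<sigma> permutes {..<3}" for \<sigma>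
    using \<mu>' that by auto
  have expectation: "(\<integral>\<omega>. G \<omega> \<partial>samples 3) = (\<integral>\<omega>. G \<omega> \<partial>m.samples 3)"
    if "order_invariant 3 G" "G \<in> borel_measurable (samples 3)" "G \<in> borel_measurable (m.samples 3)"
    for G :: "(nat \<Rightarrow> real \<times> real) \<Rightarrow> real"
    unfolding expectation_order_invariant[OF that(1,2)] m.expectation_order_invariant[OF that(1,3)]
    by (intro sum.cong refl) (auto simp: density permutes_compose permutes_inv)
  \<comment> \<open>Being weakly ordered almost surely means that an order-invariant expectation
    equals 1. It does for \<open>mu_m \<alpha>\<close>, hence also for
    \<open>\<mu>'\<close>.\<close>
  have "AE \<omega> in samples 3. weakly_ordered 3 \<omega>"
    using mu_m_weakly_ordered[OF assms, of 3] unfolding weakly_ordered_iff[symmetric] m.weakly_ordered_iff[symmetric]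
    by (subst expectation) (auto intro: order_invariant_weakly_ordered)
  moreover have "AE p in \<mu>'. above p = \<alpha> * (1 - below p)"
    using mu_m_above[OF assms]
      expectation[OF order_invariant_kernel kernel_samples_measurable m.kernel_samples_measurable, of \<alpha>]
    unfolding above_eq_iff[symmetric] m.above_eq_iff[symmetric] by simp
  ultimately have "AE p in \<mu>'. snd p = layer \<alpha> (fst p)"
    by (rule AE_snd_eq_layer[OF assms])
  then show "\<mu>' = mu_m \<alpha>"
    using \<mu>' AE_mu_m[OF assms] by (intro permuton_graph_unique[of _ _ "layer \<alpha>"]) (auto intro: permuton_mu_m assms)
qed

end
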